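(* Let $a,\nu\in\mathbb{R}$ with $\nu\ge a^2$ and let $\gamma\in(0,\infty)$. Let $\mu_{\mathrm{sc}}$ be the semicircle law supported on $[-2,2]$, and let $\sqrt{\gamma(\nu-a^2)}\,\mu_{\mathrm{sc}}$ denote the law of $\sqrt{\gamma(\nu-a^2)}\,y$ for $y\sim\mu_{\mathrm{sc}}$. Let $\mu_{\mathrm{MP},\gamma}$ be the standard Marcenko-Pastur law that is the limiting spectral measure of $n^{-1}XX^T$ when $X\in\mathbb{R}^{p\times n}$ (with i.i.d. entries of mean 0 and variance 1) and $p/n\to\gamma$, and let $a(\mu_{\mathrm{MP},\gamma}-1)$ denote the law of $a(y-1)$ for $y\sim\mu_{\mathrm{MP},\gamma}$. Then $$\mu_{a,\nu,\gamma}=a(\mu_{\mathrm{MP},\gamma}-1)\boxplus\sqrt{\gamma(\nu-a^2)}\,\mu_{\mathrm{sc}},$$ where $\boxplus$ is the additive free convolution of probability measures.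
   Context: For real $a$, $\nu\ge a^2$ and $\gamma>0$, $\mu_{a,\nu,\gamma}$ is the probability measure on $\mathbb{R}$ whose Stieltjes transform $m(z)=\int (x-z)^{-1}\mu_{a,\nu,\gamma}(dx)$ is, for every $z\in\mathbb{C}^+$ (the open upper half plane), the unique solution $m(z)\in\mathbb{C}^+$ of $$-\frac{1}{m(z)}=z+a\left(1-\frac{1}{1+a\gamma m(z)}\right)+\gamma(\nu-a^2)m(z).$$ (In the paper $a=\mathbb{E}[\xi k(\xi)]$ and $\nu=\mathbb{E}[k(\xi)^2]$ for a function $k$ and $\xi\sim\mathcal{N}(0,1)$, so $\nu\ge a^2$.) *)

theory Defs
  imports "HOL-Probability.Probability" "HOL-Library.Poly_Mapping"
begin

text \<open>
  An algebraic noncommutative probability space in the sense of Voiculescu, Dykema and Nica: a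
  unital complex algebra with a unital linear functional. Positivity is not needed, since for
  free elements the moments of the sum depend only on the moments of the summands.
  There is no type class of complex algebras in the libraries, so the scalar multiplication is a parameter.
\<close>

locale nc_prob_space = Vector_Spaces.linear smul "(*)" \<phi>
  for smul :: "complex \<Rightarrow> 'a::ring_1 \<Rightarrow> 'a" and \<phi> :: "'a \<Rightarrow> complex" +
  assumes smul_mult_left: "smul c x * y = smul c (x * y)"
    and smul_mult_right: "x * smul c y = smul c (x * y)"
    and unital: "\<phi> 1 = 1"

definition generated_subalgebra :: "(complex \<Rightarrow> 'a::ring_1 \<Rightarrow> 'a) \<Rightarrow> 'a \<Rightarrow> 'a set" where
  "generated_subalgebra smul x = module.span smul (range (\<lambda>k::nat. x ^ k))"

definition free_subalgebras :: "('a::ring_1 \<Rightarrow> complex) \<Rightarrow> ('i \<Rightarrow> 'a set) \<Rightarrow> bool" where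
  "free_subalgebras \<phi> A \<longleftrightarrow>
     (\<forall>ws :: ('i \<times> 'a) list.
        ws \<noteq> [] \<and> distinct_adj (map fst ws) \<and> (\<forall>(i, b) \<in> set ws. b \<in> A i \<and> \<phi> b = 0)
        \<longrightarrow> \<phi> (prod_list (map snd ws)) = 0)"

definition free_elements ::
    "(complex \<Rightarrow> 'a::ring_1 \<Rightarrow> 'a) \<Rightarrow> ('a \<Rightarrow> complex) \<Rightarrow> 'a \<Rightarrow> 'a \<Rightarrow> bool" where
  "free_elements smul \<phi> x y \<longleftrightarrow>
     free_subalgebras \<phi> (\<lambda>b::bool. generated_subalgebra smul (if b then x else y))"

definition compactly_supported_law :: "real measure \<Rightarrow> bool" where
  "compactly_supported_law M \<longleftrightarrow>
     prob_space M \<and> sets M = sets borel \<and> (\<exists>R. AE t in M. \<bar>t\<bar> \<le> R)"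

text \<open>
  The law of a noncommutative random variable: a compactly supported probability measure is
  determined by its moments.
\<close>

definition has_law :: "('a::ring_1 \<Rightarrow> complex) \<Rightarrow> 'a \<Rightarrow> real measure \<Rightarrow> bool" where
  "has_law \<phi> x M \<longleftrightarrow>
     compactly_supported_law M \<and> (\<forall>k::nat. \<phi> (x ^ k) = complex_of_real (\<integral>t. t ^ k \<partial>M))"

text \<open>
  Words in two letters form the free monoid on two generators, written additively because
  \<open>poly_mapping\<close> builds monoid algebras over additive monoids; the wrapper type avoids
  putting a global additive structure on lists.
\<close>

datatype nc_word = NC_Word (letters: "bool list")

instantiation nc_word :: monoid_add
begin

definition zero_nc_word :: nc_word where
  "0 = NC_Word []"

definition plus_nc_word :: "nc_word \<Rightarrow> nc_word \<Rightarrow> nc_word" where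
  "v + w = NC_Word (letters v @ letters w)"

instance
  by standard (simp_all add: zero_nc_word_def plus_nc_word_def)

end

type_synonym nc_polynomial = "nc_word \<Rightarrow>\<^sub>0 complex"

definition nc_scale :: "complex \<Rightarrow> nc_polynomial \<Rightarrow> nc_polynomial" where
  "nc_scale c p = Poly_Mapping.single 0 c * p"

text \<open>
  For compactly supported probability measures M and N, the law of x + y for freely independent
  x and y with laws M and N. HOL cannot quantify over all algebras, but it suffices
  to let x and y range over the free algebra on two generators: a pair in any
  noncommutative probability space is the image of the two indeterminates under a unital
  homomorphism, along which the functional can be pulled back without changing laws or freeness.
\<close>

definition is_free_additive_convolution ::
    "real measure \<Rightarrow> real measure \<Rightarrow> real measure \<Rightarrow> bool" where
  "is_free_additive_convolution M N P \<longleftrightarrow>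
     (\<exists>(\<phi> :: nc_polynomial \<Rightarrow> complex) x y.
        nc_prob_space nc_scale \<phi> \<and> free_elements nc_scale \<phi> x y \<and>
        has_law \<phi> x M \<and> has_law \<phi> y N \<and> has_law \<phi> (x + y) P)"

definition free_additive_convolution ::
    "real measure \<Rightarrow> real measure \<Rightarrow> real measure" (infixl \<open>\<boxplus>\<close> 65) where
  "M \<boxplus> N = (THE P. is_free_additive_convolution M N P)"

text \<open>
  The real square root of the library is negative on negative arguments, hence the indicators.
\<close>

definition semicircle_law :: "real measure" where
  "semicircle_law =
     density lborel (\<lambda>x. ennreal (indicator {-2..2} x * sqrt (4 - x\<^sup>2) / (2 * pi)))"

text \<open>
  The limiting spectral measure of \<open>X X\<^sup>T / n\<close> for p by n matrices X with p / n tending to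
  \<open>\<gamma>\<close>; for \<open>\<gamma> > 1\<close> these matrices have rank at most n < p, hence the atom at 0.
\<close>

definition mp_density :: "real \<Rightarrow> real \<Rightarrow> real" where
  "mp_density \<gamma> x =
     (let l = (1 - sqrt \<gamma>)\<^sup>2; u = (1 + sqrt \<gamma>)\<^sup>2 in
      indicator {l..u} x * sqrt ((u - x) * (x - l)) / (2 * pi * \<gamma> * x))"

definition marchenko_pastur_law :: "real \<Rightarrow> real measure" where
  "marchenko_pastur_law \<gamma> =
     measure_of UNIV (sets borel)
       (\<lambda>A. emeasure (density lborel (\<lambda>x. ennreal (mp_density \<gamma> x))) A
            + ennreal (max 0 (1 - 1 / \<gamma>)) * indicator A 0)"

definition stieltjes_transform :: "real measure \<Rightarrow> complex \<Rightarrow> complex" where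
  "stieltjes_transform \<mu> z = (\<integral>x. inverse (complex_of_real x - z) \<partial>\<mu>)"

definition kernel_law_equation :: "real \<Rightarrow> real \<Rightarrow> real \<Rightarrow> complex \<Rightarrow> complex \<Rightarrow> bool" where
  "kernel_law_equation a \<nu> \<gamma> z m \<longleftrightarrow>
     - 1 / m = z + of_real a * (1 - 1 / (1 + of_real (a * \<gamma>) * m))
               + of_real (\<gamma> * (\<nu> - a\<^sup>2)) * m"

definition is_kernel_law :: "real \<Rightarrow> real \<Rightarrow> real \<Rightarrow> real measure \<Rightarrow> bool" where
  "is_kernel_law a \<nu> \<gamma> \<mu> \<longleftrightarrow>
     prob_space \<mu> \<and> sets \<mu> = sets borel \<and>
     (\<forall>z. Im z > 0 \<longrightarrow>
        (\<forall>m. Im m > 0 \<and> kernel_law_equation a \<nu> \<gamma> z m \<longleftrightarrow> m = stieltjes_transform \<mu> z))"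

end

theory Submission
  imports Defs
begin

text \<open>
  Let \<open>x\<close> have a compactly supported law \<open>M\<close> and let \<open>y\<close> be semicircular of variance \<open>t\<close>, free
  from \<open>x\<close>. The pair is realised by \<open>x\<close> and creation plus annihilation on a Fock space over the
  polynomials in \<open>x\<close>. Decomposing powers of \<open>x + y\<close> there shows that the generating series \<open>G\<close> of
      the
  moments of \<open>x + y\<close> converges near infinity and satisfies the subordination relation
  \<open>G(z) = G\<^sub>M(z - t G(z))\<close>. When \<open>M\<close> is the law of \<open>a (y - 1)\<close> with \<open>y\<close> Marchenko-Pastur, the
      quadratic
  equation of \<open>G\<^sub>M\<close> turns this into the defining equation of \<open>\<mu>\<close> for \<open>-G\<close>. Since that equation has
  only one solution in the upper half plane, \<open>-G\<close> is the Stieltjes transform of \<open>\<mu>\<close> high up on the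
  imaginary axis; its expansion there bounds and identifies all moments of \<open>\<mu>\<close>, which is
  therefore compactly supported with the moments of \<open>x + y\<close>.
\<close>

section \<open>Functionals on Fock space\<close>

text \<open>The convolution \<open>\<boxplus>\<close> is a definite description, so two things are
  owed. Uniqueness: freeness and the two laws fix all mixed moments, and a compactly supported law
  is fixed by its moments. Existence: some law must have the moments of \<open>x + y\<close>; no
  moment problem is solved for this, because \<open>\<mu>\<close> itself turns out to be such a law.
  The obstacle is that the kernel equation says nothing direct about moments of
  \<open>\<mu>\<close>, not even that they are finite. The Fock space is chosen with scalar
  covariance: removing a \<open>\<xi>\<close> that stands behind a polynomial in \<open>x\<close>
  leaves only \<open>t\<close> times the moment of that polynomial. This is what makes
  \<open>x\<close> and \<open>y\<close> free, and it also keeps all recursions explicit enough to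
  bound and sum.\<close>

lemma poly_mapping_as_sum_single:
  fixes p :: "'a \<Rightarrow>\<^sub>0 'b::comm_monoid_add"
  shows "p = (\<Sum>w\<in>Poly_Mapping.keys p. Poly_Mapping.single w (Poly_Mapping.lookup p w))"
proof (rule poly_mapping_eqI)
  fix k
  have "Poly_Mapping.lookup (\<Sum>w\<in>Poly_Mapping.keys p. Poly_Mapping.single w (Poly_Mapping.lookup p
      w)) k
      = (\<Sum>w\<in>Poly_Mapping.keys p. if w = k then Poly_Mapping.lookup p w else 0)"
    by (simp add: lookup_sum lookup_single when_def)
  also have "\<dots> = Poly_Mapping.lookup p k"
    by (simp add: sum.delta in_keys_iff)
  finally show "Poly_Mapping.lookup p k
      = Poly_Mapping.lookup (\<Sum>w\<in>Poly_Mapping.keys p. Poly_Mapping.single w (Poly_Mapping.lookup p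
          w)) k" by simp
qed

lemma nc_scale_mult_left: "nc_scale c p * q = nc_scale c (p * q)"
  by (simp add: nc_scale_def mult.assoc)

text \<open>Scalars sit at the empty word and are central although the word algebra is not
  commutative.\<close>

lemma single_0_commute:
  fixes p :: "'a::monoid_add \<Rightarrow>\<^sub>0 'b::comm_semiring_0"
  shows "p * Poly_Mapping.single 0 c = Poly_Mapping.single 0 c * p"
  by (subst (1 2) poly_mapping_as_sum_single[of p])
    (simp add: sum_distrib_left sum_distrib_right mult_single mult.commute)

lemma nc_scale_mult_right: "p * nc_scale c q = nc_scale c (p * q)"
  by (simp add: nc_scale_def single_0_commute flip: mult.assoc)

lemma vector_space_nc_scale: "vector_space nc_scale"
proof
  fix a b :: complex and x y :: nc_polynomial
  show "nc_scale a (nc_scale b x) = nc_scale (a * b) x"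
    by (simp add: nc_scale_def mult_single flip: mult.assoc)
qed (simp_all add: nc_scale_def single_add algebra_simps)

definition ncX :: nc_polynomial where "ncX = Poly_Mapping.single (NC_Word [True]) 1"
definition ncY :: nc_polynomial where "ncY = Poly_Mapping.single (NC_Word [False]) 1"

text \<open>
  The value \<open>f i [j\<^sub>1, \<dots>, j\<^sub>n]\<close> of a functional on Fock space is its value at the basis vector
  \<open>x\<close>-power \<open>i\<close>, then for each \<open>l\<close> a letter \<open>\<xi>\<close> followed by the \<open>x\<close>-power \<open>j\<^sub>l\<close>. Operators act on
  functionals from the right, which avoids finite-support conditions; \<open>\<xi>\<close> is the created vector.
\<close>

type_synonym fock_functional = "nat \<Rightarrow> nat list \<Rightarrow> complex"

definition act_x :: "fock_functional \<Rightarrow> fock_functional" where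
  "act_x f = (\<lambda>i js. f (Suc i) js)"

definition create :: "fock_functional \<Rightarrow> fock_functional" where
  "create f = (\<lambda>i js. f 0 (i # js))"

definition f_add :: "fock_functional \<Rightarrow> fock_functional \<Rightarrow> fock_functional" where
  "f_add f g = (\<lambda>i js. f i js + g i js)"

definition f_scale :: "complex \<Rightarrow> fock_functional \<Rightarrow> fock_functional" where
  "f_scale c f = (\<lambda>i js. c * f i js)"

definition vacuum :: "(nat \<Rightarrow> complex) \<Rightarrow> fock_functional" where
  "vacuum m = (\<lambda>i js. if js = [] then m i else 0)"

locale fock =
  fixes m :: "nat \<Rightarrow> complex" and t :: complex
  assumes m_0: "m 0 = 1"
begin

text \<open>Transpose of the operator that removes the leftmost \<open>\<xi>\<close> together with
  the power \<open>x ^ i\<close> in front of it, at the price \<open>t * m i\<close>. With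
  \<open>L\<close> for creation and \<open>L'\<close> for annihilation this is the relation
  \<open>L' x ^ i L = t * m i\<close>.\<close>

definition annihilate :: "fock_functional \<Rightarrow> fock_functional" where
  "annihilate f = (\<lambda>i js. case js of [] \<Rightarrow> 0 | j # js' \<Rightarrow> t * m i * f j js')"

definition act_y :: "fock_functional \<Rightarrow> fock_functional" where
  "act_y f = f_add (create f) (annihilate f)"

text \<open>The value of \<open>f\<close> at the word applied to the vacuum vector. Operators act on
  functionals as transposes, so the leftmost letter, the outermost operator, is consumed
  first.\<close>

fun run :: "fock_functional \<Rightarrow> bool list \<Rightarrow> complex" where
  "run f [] = f 0 []"
| "run f (b # w) = run (if b then act_x f else act_y f) w"

definition ev :: "fock_functional \<Rightarrow> nc_polynomial \<Rightarrow> complex" where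
  "ev f p = (\<Sum>w\<in>Poly_Mapping.keys p. Poly_Mapping.lookup p w * run f (letters w))"

lemma ev_superset:
  assumes "finite A" "Poly_Mapping.keys p \<subseteq> A"
  shows "ev f p = (\<Sum>w\<in>A. Poly_Mapping.lookup p w * run f (letters w))"
  unfolding ev_def by (rule sum.mono_neutral_left) (use assms in \<open>auto simp: in_keys_iff\<close>)

lemma ev_add: "ev f (p + q) = ev f p + ev f q"
  unfolding ev_def
  by (rule setsum_keys_plus_distrib[where f = "\<lambda>w c. c * run f (letters w)"]) (auto simp:
      algebra_simps)

lemma ev_single [simp]: "ev f (Poly_Mapping.single w c) = c * run f (letters w)"
  by (subst ev_superset[where A = "{w}"]) auto

lemma ev_0 [simp]: "ev f 0 = 0"
  by (simp add: ev_def)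

lemma ev_sum: "ev f (\<Sum>a\<in>A. p a) = (\<Sum>a\<in>A. ev f (p a))"
  by (induction A rule: infinite_finite_induct) (auto simp: ev_add)

text \<open>Common source of \<open>ev_X\<close>, \<open>ev_Y\<close> and
  \<open>ev_nc_scale\<close>: left multiplication turns into a change of functional.\<close>

lemma ev_single_mult:
  assumes "\<And>v. c * run f (letters (u + v)) = run g (letters v)"
  shows "ev f (Poly_Mapping.single u c * p) = ev g p"
proof -
  have "ev f (Poly_Mapping.single u c * p)
    = ev f (\<Sum>w\<in>Poly_Mapping.keys p. Poly_Mapping.single u c * Poly_Mapping.single w
        (Poly_Mapping.lookup p w))"
    by (subst poly_mapping_as_sum_single[of p]) (simp add: sum_distrib_left)
  also have "\<dots> = (\<Sum>w\<in>Poly_Mapping.keys p. c * Poly_Mapping.lookup p w * run f (letters (u + w)))"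
    by (simp add: ev_sum mult_single)
  also have "\<dots> = ev g p"
    by (simp add: ev_def assms[symmetric] algebra_simps)
  finally show ?thesis .
qed

lemma ev_X: "ev f (ncX * p) = ev (act_x f) p"
  unfolding ncX_def by (rule ev_single_mult) (simp add: plus_nc_word_def)

lemma ev_Y: "ev f (ncY * p) = ev (act_y f) p"
  unfolding ncY_def by (rule ev_single_mult) (simp add: plus_nc_word_def)

lemma run_add: "run (f_add f g) w = run f w + run g w"
proof (induction w arbitrary: f g)
  case (Cons b w)
  have "act_x (f_add f g) = f_add (act_x f) (act_x g)" "act_y (f_add f g) = f_add (act_y f) (act_y
      g)"
    by (auto simp: act_x_def act_y_def f_add_def create_def annihilate_def algebra_simps fun_eq_iff
        split: list.splits)
  then show ?case by (simp add: Cons)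
qed (simp add: f_add_def)

lemma run_scale: "run (f_scale c f) w = c * run f w"
proof (induction w arbitrary: f)
  case (Cons b w)
  have "act_x (f_scale c f) = f_scale c (act_x f)" "act_y (f_scale c f) = f_scale c (act_y f)"
    by (auto simp: act_x_def act_y_def f_add_def f_scale_def create_def annihilate_def
        algebra_simps fun_eq_iff split: list.splits)
  then show ?case by (simp add: Cons)
qed (simp add: f_scale_def)

lemma ev_f_add: "ev (f_add f g) p = ev f p + ev g p"
  by (simp add: ev_def run_add algebra_simps sum.distrib)

lemma ev_f_scale: "ev (f_scale c f) p = c * ev f p"
  by (simp add: ev_def run_scale algebra_simps sum_distrib_left)

lemma ev_nc_scale: "ev f (nc_scale c p) = c * ev f p"
  unfolding nc_scale_def ev_f_scale[symmetric]
  by (rule ev_single_mult) (simp add: run_scale)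

lemma ev_1: "ev f 1 = f 0 []"
  by (simp flip: single_one add: zero_nc_word_def)

lemma nc_prob_space_ev:
  assumes "f 0 [] = 1"
  shows "nc_prob_space nc_scale (ev f)"
proof -
  interpret V: vector_space nc_scale by (rule vector_space_nc_scale)
  show ?thesis
    by unfold_locales
      (simp_all add: ev_add ev_nc_scale ev_1 assms nc_scale_mult_left nc_scale_mult_right
          algebra_simps)
qed

end

section \<open>Freeness\<close>

text \<open>Chebyshev polynomials of the second kind, normalised to be monic and orthogonal for the
  semicircle law of variance \<open>c\<close>. The parameter \<open>c\<close> is a ring element so
  that it can also be a constant of the word algebra.\<close>

fun cheb :: "'a::ring_1 \<Rightarrow> 'a \<Rightarrow> nat \<Rightarrow> 'a" where
  "cheb c y 0 = 1"
| "cheb c y (Suc 0) = y"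
| "cheb c y (Suc (Suc n)) = y * cheb c y (Suc n) - c * cheb c y n"

section \<open>Centred alternating products in the Fock space\<close>

context fock begin

definition uY :: "nat \<Rightarrow> nc_polynomial" where
  "uY n = cheb (Poly_Mapping.single 0 t) ncY n"

definition eX :: "nat \<Rightarrow> nc_polynomial" where
  "eX i = ncX ^ i - nc_scale (m i) 1"

definition shift_x :: "nat \<Rightarrow> fock_functional \<Rightarrow> fock_functional" where
  "shift_x k f = (\<lambda>i js. f (k + i) js - m k * f i js)"

lemma ev_diff: "ev f (p - q) = ev f p - ev f q"
  using ev_add[of f "p - q" q] by simp

lemma act_x_pow: "(act_x ^^ k) f = (\<lambda>i js. f (k + i) js)"
  by (induction k arbitrary: f) (auto simp: act_x_def fun_eq_iff)

lemma ev_X_power: "ev f (ncX ^ k * p) = ev ((act_x ^^ k) f) p"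
  by (induction k arbitrary: f) (auto simp: mult.assoc ev_X funpow_swap1)

lemma ev_eX: "ev f (eX k * p) = ev (shift_x k f) p"
proof -
  have "shift_x k f = f_add ((act_x ^^ k) f) (f_scale (- m k) f)"
    by (auto simp: shift_x_def act_x_pow f_add_def f_scale_def fun_eq_iff)
  then show ?thesis
    by (simp add: eX_def left_diff_distrib ev_diff ev_X_power ev_f_add ev_f_scale
        nc_scale_mult_left ev_nc_scale)
qed

text \<open>The relation \<open>L' L = t\<close>: no power of \<open>x\<close> stands in between, so
  the moment involved is \<open>m 0 = 1\<close>.\<close>

lemma create_annihilate: "create (annihilate f) = f_scale t f"
  by (auto simp: create_def annihilate_def f_scale_def m_0 fun_eq_iff)

lemma create_f_add: "create (f_add f g) = f_add (create f) (create g)"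
  by (simp add: create_def f_add_def)

lemma create_f_scale: "create (f_scale c g) = f_scale c (create g)"
  by (simp add: create_def f_scale_def)

lemma create_pow_f_add: "(create ^^ n) (f_add f g) = f_add ((create ^^ n) f) ((create ^^ n) g)"
  by (induction n) (auto simp: create_f_add)

lemma create_pow_f_scale: "(create ^^ n) (f_scale c g) = f_scale c ((create ^^ n) g)"
  by (induction n) (auto simp: create_f_scale)

text \<open>The hypothesis says that annihilation kills the vector \<open>p\<close> applied to the
  vacuum. On such a vector the Chebyshev polynomial in \<open>y = L + L'\<close> acts as the pure
  creation \<open>L ^ n\<close>: the subtracted term of the recursion cancels exactly the
  contribution of \<open>L' L = t\<close>.\<close>

lemma ev_uY:
  assumes "\<And>g. ev (annihilate g) p = 0"
  shows "ev f (uY n * p) = ev ((create ^^ n) f) p"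
proof (induction n arbitrary: f rule: less_induct)
  case (less n)
  consider "n = 0" | "n = 1" | k where "n = Suc (Suc k)"
    by (metis One_nat_def not0_implies_Suc)
  then show ?case
  proof cases
    case 3
    have "ev f (uY n * p) = ev (act_y f) (uY (Suc k) * p) - ev f (nc_scale t (uY k * p))"
      by (simp add: 3 uY_def left_diff_distrib ev_diff ev_Y mult.assoc nc_scale_def)
    also have "\<dots> = ev ((create ^^ Suc k) (act_y f)) p - t * ev ((create ^^ k) f) p"
      by (simp add: 3 less ev_nc_scale)
    also have "(create ^^ Suc k) (act_y f) = f_add ((create ^^ n) f) (f_scale t ((create ^^ k) f))"
      by (simp add: 3 act_y_def create_pow_f_add funpow_Suc_right create_f_add create_annihilate
          create_pow_f_scale del: funpow.simps)
    finally show ?thesis by (simp add: ev_f_add ev_f_scale)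
  qed (auto simp: uY_def ev_Y act_y_def ev_f_add assms)
qed

text \<open>Tokens \<open>(True, k)\<close> and \<open>(False, k)\<close> stand for the centred elements of the two subalgebras;
  the index is shifted for \<open>y\<close> since the Chebyshev polynomial of index 0 is not centred.\<close>

definition token :: "bool \<times> nat \<Rightarrow> nc_polynomial" where
  "token bk = (if fst bk then eX (snd bk) else uY (Suc (snd bk)))"

abbreviation tokens :: "(bool \<times> nat) list \<Rightarrow> nc_polynomial" where
  "tokens ts \<equiv> prod_list (map token ts)"

text \<open>Annihilation finds either no \<open>\<xi>\<close> at all or a leftmost
  \<open>\<xi>\<close> behind a centred polynomial in \<open>x\<close>, whose moment is zero. The
  induction removes two tokens at a time, since \<open>ev_uY\<close> for the second token needs the
  claim for what follows it.\<close>

lemma ev_annihilate_tokens: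
  assumes "distinct_adj (map fst ts)" "ts = [] \<or> fst (hd ts)"
  shows "ev (annihilate f) (tokens ts) = 0"
  using assms
proof (induction "length ts" arbitrary: ts f rule: less_induct)
  case less
  show ?case
  proof (cases ts)
    case Nil
    then show ?thesis by (simp add: ev_1 annihilate_def)
  next
    case (Cons a us)
    then obtain k where a: "a = (True, k)" using less.prems by (cases a) auto
    have 1: "ev (annihilate f) (tokens ts) = ev (shift_x k (annihilate f)) (tokens us)"
      by (simp add: Cons a token_def ev_eX)
    show ?thesis
    proof (cases us)
      case Nil
      then show ?thesis using 1 by (simp add: ev_1 annihilate_def shift_x_def)
    next
      case (Cons b vs)
      with \<open>ts = a # us\<close> less.prems a obtain l where b: "b = (False, l)"
        by (cases b) auto
      have vs: "distinct_adj (map fst vs)" "vs = [] \<or> fst (hd vs)"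
        using less.prems \<open>ts = a # us\<close> Cons a b by (cases vs; auto)+
      have "length vs < length ts" using \<open>ts = a # us\<close> Cons by simp
      then have "ev (annihilate g) (tokens vs) = 0" for g
        using less.hyps vs by blast
      then have "ev (shift_x k (annihilate f)) (tokens us)
         = ev ((create ^^ l) (create (shift_x k (annihilate f)))) (tokens vs)"
        by (simp add: Cons b token_def ev_uY funpow_Suc_right del: funpow.simps)
      \<comment> \<open>This is \<open>L' (x ^ k - m k) L = t * (m k - m k) = 0\<close>, with the
        zero functional written as a multiple of \<open>f\<close>.\<close>
      also have "create (shift_x k (annihilate f)) = f_scale 0 f"
        by (auto simp: create_def shift_x_def annihilate_def f_scale_def fun_eq_iff m_0)
      finally show ?thesis using 1 by (simp add: create_pow_f_scale ev_f_scale)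
    qed
  qed
qed

text \<open>A leading \<open>y\<close>-token creates a \<open>\<xi>\<close>, on which the vacuum
  functional vanishes. A leading centred power of \<open>x\<close> preserves this vanishing, and
  when it stands alone it gives \<open>m k - m k\<close>.\<close>

lemma ev_vacuum_tokens:
  assumes "distinct_adj (map fst ts)" "ts \<noteq> []"
  shows "ev (vacuum m) (tokens ts) = 0"
proof -
  have *: "ev f (tokens us) = 0" if us_props: "distinct_adj (map fst us)" "us \<noteq> []" "\<not> fst (hd
      us)" "create f = f_scale 0 f" for f us
  proof -
    obtain l vs where us: "us = (False, l) # vs"
      using us_props by (cases us) auto
    have vs: "distinct_adj (map fst vs)" "vs = [] \<or> fst (hd vs)"
      using us_props us by (cases vs; auto)+
    have "ev f (tokens us) = ev ((create ^^ l) (create f)) (tokens vs)"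
      using ev_annihilate_tokens[OF vs]
      by (simp add: us token_def ev_uY funpow_Suc_right del: funpow.simps)
    then show ?thesis by (simp add: us_props create_pow_f_scale ev_f_scale)
  qed
  show ?thesis
  proof (cases "fst (hd ts)")
    case False
    then show ?thesis using assms by (intro *) (auto simp: create_def vacuum_def f_scale_def)
  next
    case True
    then obtain k us where ts: "ts = (True, k) # us"
      using assms by (cases ts) auto
    have 1: "ev (vacuum m) (tokens ts) = ev (shift_x k (vacuum m)) (tokens us)"
      by (simp add: ts token_def ev_eX)
    show ?thesis
    proof (cases "us = []")
      case True
      then show ?thesis using 1 by (simp add: ev_1 shift_x_def vacuum_def m_0)
    next
      case False
      have "ev (shift_x k (vacuum m)) (tokens us) = 0"
        using assms ts False
        by (intro *) (cases us; auto simp: create_def vacuum_def f_scale_def shift_x_def)+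
      then show ?thesis using 1 by simp
    qed
  qed
qed

definition centred :: "bool \<Rightarrow> nc_polynomial set" where
  "centred b = module.span nc_scale (range (\<lambda>k. token (b, k)))"

text \<open>The prefix \<open>ts\<close> collects the factors already expanded into tokens.
  Alternation depends only on the labels, so it survives the replacement of a factor by a
  token.\<close>

lemma ev_vacuum_centred_product:
  assumes "distinct_adj (map fst ts @ map fst ws)" "ts \<noteq> [] \<or> ws \<noteq> []"
    "\<forall>(i, b) \<in> set ws. b \<in> centred i"
  shows "ev (vacuum m) (tokens ts * prod_list (map snd ws)) = 0"
  using assms
proof (induction ws arbitrary: ts)
  case Nil
  then show ?case using ev_vacuum_tokens by simp
next
  case (Cons w ws)
  interpret V: vector_space nc_scale by (rule vector_space_nc_scale)
  obtain i b where w: "w = (i, b)" by (cases w)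
  have "b \<in> V.span (range (\<lambda>k. token (i, k)))" using Cons.prems(3) by (simp add: w centred_def)
  then show ?case unfolding w
  proof (induction b rule: V.span_induct_alt)
    case base
    then show ?case by simp
  next
    case (step c x y)
    then obtain k where x: "x = token (i, k)" by auto
    have "ev (vacuum m) (tokens (ts @ [(i, k)]) * prod_list (map snd ws)) = 0"
      using Cons.prems by (intro Cons.IH) (auto simp: w)
    then show ?case using step
      by (simp add: x ring_distribs ev_add nc_scale_mult_left nc_scale_mult_right ev_nc_scale
          mult.assoc)
  qed
qed

lemma ev_vacuum_1: "ev (vacuum m) 1 = 1"
  by (simp add: ev_1 vacuum_def m_0)

text \<open>Change of basis from monomials to Chebyshev polynomials: the recursion reads
  \<open>y U_n = U_(n+1) + t U_(n-1)\<close>.\<close>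

lemma power_Y_in_span: "ncY ^ k \<in> module.span nc_scale (range uY)"
proof -
  interpret V: vector_space nc_scale by (rule vector_space_nc_scale)
  have *: "ncY * p \<in> V.span (range uY)" if "p \<in> V.span (range uY)" for p
    using that
  proof (induction p rule: V.span_induct_alt)
    case base
    then show ?case by (simp add: V.span_zero)
  next
    case (step c x y)
    then obtain n where x: "x = uY n" by auto
    have "ncY * uY n \<in> V.span (range uY)"
    proof (cases n)
      case 0
      then have "ncY * uY n = uY 1" by (simp add: uY_def)
      then show ?thesis using V.span_base[of _ "range uY"] by (metis rangeI)
    next
      case (Suc k)
      then have "ncY * uY n = uY (Suc n) + nc_scale t (uY k)"
        by (simp add: uY_def nc_scale_def)
      then show ?thesis by (simp add: V.span_add V.span_base V.span_scale)
    qed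
    then show ?case using step
      by (simp add: x ring_distribs nc_scale_mult_right V.span_add V.span_scale)
  qed
  show ?thesis
  proof (induction k)
    case 0
    have "uY 0 = 1" by (simp add: uY_def)
    then show ?case using V.span_base[of "uY 0" "range uY"] by simp
  next
    case (Suc k)
    then show ?case by (simp add: *)
  qed
qed

text \<open>Subtracting the mean is linear, so it suffices to centre the spanning elements; powers
  of \<open>x\<close> and Chebyshev polynomials in \<open>y\<close> become tokens or zero.\<close>

lemma centred_if_generated:
  assumes "p \<in> generated_subalgebra nc_scale (if b then ncX else ncY)" "ev (vacuum m) p = 0"
  shows "p \<in> centred b"
proof -
  interpret V: vector_space nc_scale by (rule vector_space_nc_scale)
  let ?c = "\<lambda>p. p - nc_scale (ev (vacuum m) p) 1"
  define S where "S = (if b then range (\<lambda>k. ncX ^ k) else range uY)"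
  have "p \<in> V.span S"
  proof (cases b)
    case False
    then have "range (\<lambda>k. ncY ^ k) \<subseteq> V.span S" using power_Y_in_span by (auto simp: S_def)
    then show ?thesis using assms(1) False V.span_minimal[OF _ V.subspace_span]
      unfolding generated_subalgebra_def by auto
  qed (use assms(1) in \<open>simp_all add: generated_subalgebra_def S_def\<close>)
  then have "?c p \<in> centred b"
  proof (induction p rule: V.span_induct_alt)
    case base
    then show ?case by (simp add: centred_def V.span_zero)
  next
    case (step c x y)
    have "?c x \<in> centred b"
    proof (cases b)
      case True
      then obtain k where x: "x = ncX ^ k" using step by (auto simp: S_def)
      have "ev (vacuum m) x = m k"
        using ev_X_power[of "vacuum m" k 1] by (simp add: x ev_1 act_x_pow vacuum_def)
      then have "?c x = token (b, k)" using True by (simp add: token_def x eX_def)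
      then show ?thesis unfolding centred_def using V.span_base by fastforce
    next
      case False
      then obtain k where x: "x = uY k" using step by (auto simp: S_def)
      show ?thesis
      proof (cases k)
        case 0
        then show ?thesis by (simp add: x uY_def ev_vacuum_1 centred_def V.span_zero)
      next
        case (Suc l)
        then have "x = token (b, l)" using False by (simp add: x token_def)
        moreover have "ev (vacuum m) (token (b, l)) = 0"
          using ev_vacuum_tokens[of "[(b, l)]"] by simp
        ultimately show ?thesis unfolding centred_def using V.span_base by fastforce
      qed
    qed
    moreover have "?c (nc_scale c x + y) = nc_scale c (?c x) + ?c y"
      by (simp add: ev_add ev_nc_scale algebra_simps)
    ultimately show ?case using step unfolding centred_def by (metis V.span_add V.span_scale)
  qed
  then show ?thesis using assms(2) by simp
qed

lemma free_elements_vacuum: "free_elements nc_scale (ev (vacuum m)) ncX ncY"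
  unfolding free_elements_def free_subalgebras_def
proof (intro allI impI, elim conjE)
  fix ws :: "(bool \<times> nc_polynomial) list"
  assume ws: "ws \<noteq> []" "distinct_adj (map fst ws)"
    "\<forall>(i, b)\<in>set ws. b \<in> generated_subalgebra nc_scale (if i then ncX else ncY) \<and> ev (vacuum m) b
        = 0"
  then have "\<forall>(i, b)\<in>set ws. b \<in> centred i" using centred_if_generated by blast
  then show "ev (vacuum m) (prod_list (map snd ws)) = 0"
    using ev_vacuum_centred_product[of "[]" ws] ws by simp
qed

end

section \<open>Mixed moments of free elements are determined by the two laws\<close>

context nc_prob_space begin

definition letter_prod :: "'a \<Rightarrow> 'a \<Rightarrow> (bool \<times> nat) list \<Rightarrow> 'a" where
  "letter_prod x y ts = prod_list (map (\<lambda>(b, k). (if b then x else y) ^ k) ts)"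

definition centred_prod :: "'a \<Rightarrow> 'a \<Rightarrow> (bool \<times> nat) list \<Rightarrow> 'a" where
  "centred_prod x y ts = prod_list (map (\<lambda>(b, k).
     (if b then x else y) ^ k - smul (\<phi> ((if b then x else y) ^ k)) 1) ts)"

lemma letter_prod_merge:
  "letter_prod x y (us @ (b, k) # (b, l) # vs) = letter_prod x y (us @ (b, k + l) # vs)"
  by (simp add: letter_prod_def power_add mult.assoc)

lemma letter_prod_snoc: "letter_prod x y (us @ [(b, k)]) = letter_prod x y us * (if b then x else
    y) ^ k"
  by (simp add: letter_prod_def)

text \<open>Adding and subtracting the mean moves the first plain letter to the end of the centred
  prefix; the correction term has one letter fewer.\<close>

lemma centred_letter_prod_Cons:
  "\<phi> (centred_prod x y us * letter_prod x y ((b, k) # vs))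
   = \<phi> (centred_prod x y (us @ [(b, k)]) * letter_prod x y vs)
     + \<phi> ((if b then x else y) ^ k) * \<phi> (centred_prod x y us * letter_prod x y vs)"
  by (simp add: letter_prod_def centred_prod_def algebra_simps smul_mult_left smul_mult_right
      add scale diff)

lemma phi_centred_prod:
  assumes "free_elements smul \<phi> x y" "ts \<noteq> []" "distinct_adj (map fst ts)"
  shows "\<phi> (centred_prod x y ts) = 0"
proof -
  define ws where "ws = map (\<lambda>(b, k). (b, (if b then x else y) ^ k - smul (\<phi> ((if b then x else y)
      ^ k)) 1)) ts"
  have ws: "map fst ws = map fst ts" "prod_list (map snd ws) = centred_prod x y ts"
    by (auto simp: ws_def centred_prod_def comp_def case_prod_unfold)
  have "c \<in> generated_subalgebra smul (if b then x else y) \<and> \<phi> c = 0" if c: "(b, c) \<in> set ws" for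
      b c
  proof -
    let ?z = "if b then x else y"
    obtain k where c: "c = ?z ^ k - smul (\<phi> (?z ^ k)) 1" using c by (auto simp: ws_def)
    have "?z ^ i \<in> generated_subalgebra smul ?z" for i
      unfolding generated_subalgebra_def by (rule vs1.span_base) auto
    from this[of k] this[of 0] have "c \<in> generated_subalgebra smul ?z"
      unfolding c generated_subalgebra_def by (intro vs1.span_diff vs1.span_scale) simp_all
    then show ?thesis by (simp add: c diff scale unital)
  qed
  then have "\<forall>(b, c) \<in> set ws. c \<in> generated_subalgebra smul (if b then x else y) \<and> \<phi> c = 0"
    by blast
  moreover have "ws \<noteq> []" using assms(2) by (simp add: ws_def)
  ultimately show ?thesis
    using assms(1,3) unfolding free_elements_def free_subalgebras_def ws(2)[symmetric]
        ws(1)[symmetric]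
    by blast
qed

end

locale two_nc_prob_spaces = A: nc_prob_space smul \<phi> + B: nc_prob_space smul' \<phi>'
  for smul :: "complex \<Rightarrow> 'a::ring_1 \<Rightarrow> 'a" and \<phi> :: "'a \<Rightarrow> complex"
    and smul' :: "complex \<Rightarrow> 'b::ring_1 \<Rightarrow> 'b" and \<phi>' :: "'b \<Rightarrow> complex" +
  fixes x y :: 'a and x' y' :: 'b
  assumes free: "free_elements smul \<phi> x y" "free_elements smul' \<phi>' x' y'"
    and moments: "\<phi> (x ^ k) = \<phi>' (x' ^ k)" "\<phi> (y ^ k) = \<phi>' (y' ^ k)"
begin

lemma letter_moments: "\<phi> ((if b then x else y) ^ k) = \<phi>' ((if b then x' else y') ^ k)"
  by (simp add: moments)

text \<open>The preceding identity read backwards: expanding the centred letters produces only words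
  no longer than the product itself.\<close>

lemma centred_letter_prod_eq:
  assumes "\<And>ts. length ts \<le> n \<Longrightarrow> \<phi> (A.letter_prod x y ts) = \<phi>' (B.letter_prod x' y' ts)"
    and "length us + length vs \<le> n"
  shows "\<phi> (A.centred_prod x y us * A.letter_prod x y vs)
       = \<phi>' (B.centred_prod x' y' us * B.letter_prod x' y' vs)"
  using assms(2)
proof (induction us arbitrary: vs rule: rev_induct)
  case Nil
  then show ?case using assms(1)[of vs] by (simp add: A.centred_prod_def B.centred_prod_def)
next
  case (snoc u us)
  obtain b k where u: "u = (b, k)" by (cases u)
  show ?case
    using A.centred_letter_prod_Cons[of x y us b k vs] B.centred_letter_prod_Cons[of x' y' us b k
        vs]
      snoc.IH[of "(b, k) # vs"] snoc.IH[of vs] snoc.prems letter_moments[of b k]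
    by (simp add: u)
qed

text \<open>Equal neighbours merge into a shorter word. In an alternating word the letters are
  centred from left to right; each exchange costs a shorter product, and the fully centred word
  vanishes on both sides by freeness.\<close>

lemma letter_prod_eq: "\<phi> (A.letter_prod x y ts) = \<phi>' (B.letter_prod x' y' ts)"
proof (induction "length ts" arbitrary: ts rule: less_induct)
  case less
  show ?case
  proof (cases "distinct_adj (map fst ts)")
    case True
    have "\<phi> (A.centred_prod x y us * A.letter_prod x y vs)
       = \<phi>' (B.centred_prod x' y' us * B.letter_prod x' y' vs)" if "ts = us @ vs" for us vs
      using that
    proof (induction vs arbitrary: us)
      case Nil
      show ?case
      proof (cases "us = []")
        case True
        then show ?thesis
          by (simp add: A.centred_prod_def B.centred_prod_def A.letter_prod_def B.letter_prod_def
              A.unital B.unital)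
      next
        case False
        then show ?thesis using Nil \<open>distinct_adj _\<close> A.phi_centred_prod[OF free(1)]
            B.phi_centred_prod[OF free(2)]
          by (simp add: A.letter_prod_def B.letter_prod_def)
      qed
    next
      case (Cons v vs)
      obtain b k where v: "v = (b, k)" by (cases v)
      \<comment> \<open>The correction term has lost the letter \<open>v\<close>, hence the bound
        \<open>length ts - 1\<close>.\<close>
      have "\<phi> (A.centred_prod x y us * A.letter_prod x y vs)
        = \<phi>' (B.centred_prod x' y' us * B.letter_prod x' y' vs)"
        by (rule centred_letter_prod_eq[where n = "length ts - 1"])
          (use less Cons.prems in auto)
      then show ?case
        using Cons.IH[of "us @ [v]"] Cons.prems letter_moments[of b k]
        by (simp add: v A.centred_letter_prod_Cons B.centred_letter_prod_Cons)
    qed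
    from this[of "[]" ts] show ?thesis by (simp add: A.centred_prod_def B.centred_prod_def)
  next
    case False
    then obtain us b k l vs where ts: "ts = us @ (b, k) # (b, l) # vs"
    proof (induction ts arbitrary: thesis)
      case (Cons a ts)
      show ?case
      proof (cases "distinct_adj (map fst ts)")
        case True
        then obtain b k l cs where "ts = (b, l) # cs" "a = (b, k)"
          using Cons.prems(2) by (cases a; cases ts) auto
        then show ?thesis using Cons.prems(1)[of "[]"] by simp
      next
        case False
        then obtain us b k l vs where "ts = us @ (b, k) # (b, l) # vs" using Cons.IH by blast
        then show ?thesis using Cons.prems(1)[of "a # us"] by simp
      qed
    qed simp
    show ?thesis using less[of "us @ (b, k + l) # vs"]
      by (simp add: ts A.letter_prod_merge B.letter_prod_merge)
  qed
qed

lemma sum_power_eq: "\<phi> ((x + y) ^ n) = \<phi>' ((x' + y') ^ n)"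
proof -
  have "\<phi> (A.letter_prod x y ts * (x + y) ^ n) = \<phi>' (B.letter_prod x' y' ts * (x' + y') ^ n)" for ts
  proof (induction n arbitrary: ts)
    case 0
    then show ?case using letter_prod_eq by simp
  next
    case (Suc n)
    from Suc[of "ts @ [(True, 1)]"] Suc[of "ts @ [(False, 1)]"] show ?case
      by (simp add: A.letter_prod_snoc B.letter_prod_snoc mult.assoc ring_distribs A.add B.add)
  qed
  from this[of "[]"] show ?thesis by (simp add: A.letter_prod_def B.letter_prod_def)
qed

end

section \<open>Moments of the sum\<close>

context fock begin

definition sum_moment :: "nat \<Rightarrow> fock_functional \<Rightarrow> complex" where
  "sum_moment n f = ev f ((ncX + ncY) ^ n)"

lemma sum_moment_0: "sum_moment 0 f = f 0 []"
  by (simp add: sum_moment_def ev_1)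

lemma sum_moment_Suc: "sum_moment (Suc n) f = sum_moment n (act_x f) + sum_moment n (act_y f)"
  by (simp add: sum_moment_def ev_X ev_Y distrib_right ev_add)

lemma sum_moment_Suc': "sum_moment (Suc n) f = sum_moment n (f_add (act_x f) (act_y f))"
  unfolding sum_moment_Suc by (simp add: sum_moment_def ev_f_add)

lemma sum_moment_f_add: "sum_moment n (f_add f g) = sum_moment n f + sum_moment n g"
  by (simp add: sum_moment_def ev_f_add)

lemma sum_moment_f_scale: "sum_moment n (f_scale c f) = c * sum_moment n f"
  by (simp add: sum_moment_def ev_f_scale)

text \<open>Evaluation of polynomials in \<open>x\<close> at a point, extended by zero to vectors
  containing \<open>\<xi>\<close>. Its average over the law of \<open>x\<close> is the vacuum
  functional.\<close>

definition geometric :: "complex \<Rightarrow> fock_functional" where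
  "geometric x = (\<lambda>i js. if js = [] then x ^ i else 0)"

text \<open>
  Splitting a power of \<open>x + y\<close> at the last step that creates the rightmost \<open>\<xi>\<close> gives the
  convolution in the next lemma; it is the source of the subordination relation.
\<close>

definition append_geometric :: "fock_functional \<Rightarrow> complex \<Rightarrow> fock_functional" where
  "append_geometric h x = (\<lambda>i js. if js = [] then 0 else h i (butlast js) * x ^ last js)"

lemma sum_moment_append_geometric:
  "sum_moment n (append_geometric h x)
   = (\<Sum>j<n. sum_moment j h * sum_moment (n - 1 - j) (geometric x))"
proof (induction n arbitrary: h)
  case 0
  then show ?case by (simp add: sum_moment_0 append_geometric_def)
next
  case (Suc n)
  have x: "act_x (append_geometric h x) = append_geometric (act_x h) x"
    by (auto simp: act_x_def append_geometric_def)
  \<comment> \<open>The extra term is the creation of the rightmost \<open>\<xi>\<close>: the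
    letters to its left have produced the number \<open>h 0 []\<close>, those to its right start
    afresh from \<open>geometric x\<close>.\<close>
  have y: "act_y (append_geometric h x)
      = f_add (append_geometric (act_y h) x) (f_scale (h 0 []) (geometric x))"
    by (auto simp: act_y_def append_geometric_def fun_eq_iff f_add_def create_def annihilate_def
        f_scale_def geometric_def algebra_simps split: list.splits)
  have "sum_moment (Suc n) (append_geometric h x)
      = sum_moment n (append_geometric (act_x h) x) + sum_moment n (append_geometric (act_y h) x)
        + h 0 [] * sum_moment n (geometric x)"
    by (simp add: sum_moment_Suc x y sum_moment_f_add sum_moment_f_scale)
  also have "\<dots> = (\<Sum>j<n. sum_moment (Suc j) h * sum_moment (n - Suc j) (geometric x))
        + sum_moment 0 h * sum_moment n (geometric x)"
    by (simp add: Suc sum_moment_Suc[of _ h] sum_moment_0 distrib_right flip: sum.distrib)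
  also have "\<dots> = (\<Sum>j<Suc n. sum_moment j h * sum_moment (Suc n - 1 - j) (geometric x))"
    by (subst sum.lessThan_Suc_shift) simp
  finally show ?case .
qed

text \<open>The outermost letter is \<open>x\<close>, which multiplies by the point, or an
  annihilation, because the functional vanishes on freshly created vectors. The annihilation yields
  \<open>append_geometric (vacuum m) x\<close>, which brings in the moments of the sum.\<close>

lemma sum_moment_geometric_Suc:
  "sum_moment (Suc n) (geometric x) = x * sum_moment n (geometric x)
     + t * (\<Sum>j<n. sum_moment j (vacuum m) * sum_moment (n - 1 - j) (geometric x))"
proof -
  have "act_x (geometric x) = f_scale x (geometric x)"
    by (auto simp: act_x_def geometric_def f_scale_def fun_eq_iff)
  moreover have "act_y (geometric x) = f_scale t (append_geometric (vacuum m) x)"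
    by (auto simp: act_y_def geometric_def f_scale_def fun_eq_iff f_add_def create_def
        annihilate_def
       append_geometric_def vacuum_def butlast_conv_take split: list.splits)
  ultimately show ?thesis
    by (simp add: sum_moment_Suc sum_moment_f_scale sum_moment_append_geometric)
qed

text \<open>Each letter forms finite linear combinations of coordinates, so a pointwise average of
  functionals passes through every word.\<close>

lemma run_integral:
  fixes g :: "'b \<Rightarrow> fock_functional"
  assumes "\<And>i js. integrable M (\<lambda>x. g x i js)"
  shows "integrable M (\<lambda>x. run (g x) w) \<and> run (\<lambda>i js. \<integral>x. g x i js \<partial>M) w = (\<integral>x. run (g x) w \<partial>M)"
  using assms
proof (induction w arbitrary: g)
  case (Cons b w)
  let ?G = "\<lambda>i js. \<integral>x. g x i js \<partial>M"
  have int: "integrable M (\<lambda>x. act_x (g x) i js)" "integrable M (\<lambda>x. act_y (g x) i js)" for i js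
    using Cons.prems
    by (cases js; simp add: act_x_def act_y_def f_add_def create_def annihilate_def)+
  have x: "act_x ?G = (\<lambda>i js. \<integral>x. act_x (g x) i js \<partial>M)"
    by (simp add: act_x_def)
  have y: "act_y ?G = (\<lambda>i js. \<integral>x. act_y (g x) i js \<partial>M)"
    using Cons.prems
    by (auto simp: act_y_def f_add_def create_def annihilate_def fun_eq_iff split: list.splits)
  have "run (\<lambda>i js. \<integral>x. act_x (g x) i js \<partial>M) w = (\<integral>x. run (act_x (g x)) w \<partial>M)"
    "run (\<lambda>i js. \<integral>x. act_y (g x) i js \<partial>M) w = (\<integral>x. run (act_y (g x)) w \<partial>M)"
    "integrable M (\<lambda>x. run (act_x (g x)) w)" "integrable M (\<lambda>x. run (act_y (g x)) w)"
    using Cons.IH[of "\<lambda>x. act_x (g x)"] Cons.IH[of "\<lambda>x. act_y (g x)"] int by blast+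
  then show ?case
    by (cases b) (simp_all add: x y)
qed auto

lemma ev_integral:
  fixes g :: "'b \<Rightarrow> fock_functional"
  assumes "\<And>i js. integrable M (\<lambda>x. g x i js)"
  shows "integrable M (\<lambda>x. ev (g x) p)"
    and "ev (\<lambda>i js. \<integral>x. g x i js \<partial>M) p = (\<integral>x. ev (g x) p \<partial>M)"
  using run_integral[OF assms] by (simp_all add: ev_def)

lemma vacuum_X_power: "ev (vacuum m) (ncX ^ k) = m k"
  using ev_X_power[of "vacuum m" k 1] by (simp add: ev_1 act_x_pow vacuum_def)

text \<open>
  The three-term recursion makes this functional an eigenvector of \<open>y\<close>. Averaging over the
  semicircle law leaves only the vacuum, by orthogonality.
\<close>

definition eigenfunctional :: "complex \<Rightarrow> fock_functional" where
  "eigenfunctional y = (\<lambda>i js. m i * prod_list (map m js) * cheb t y (length js))"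

lemma ev_eigenfunctional: "ev (eigenfunctional y) (ncY ^ k) = y ^ k"
proof (induction k)
  case 0
  then show ?case by (simp add: ev_1 eigenfunctional_def m_0)
next
  case (Suc k)
  have "act_y (eigenfunctional y) = f_scale y (eigenfunctional y)"
    by (auto simp: act_y_def f_add_def create_def annihilate_def f_scale_def eigenfunctional_def
        fun_eq_iff m_0 algebra_simps split: list.splits)
  then show ?case by (simp add: ev_Y ev_f_scale Suc)
qed

lemma vacuum_Y_power:
  assumes "\<And>n. integrable N (\<lambda>y. cheb t (complex_of_real y) n)"
    and "\<And>n. (\<integral>y. cheb t (complex_of_real y) n \<partial>N) = (if n = 0 then 1 else 0)"
  shows "ev (vacuum m) (ncY ^ k) = (\<integral>y. complex_of_real y ^ k \<partial>N)"
proof -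
  have "vacuum m = (\<lambda>i js. \<integral>y. eigenfunctional (complex_of_real y) i js \<partial>N)"
    by (auto simp: vacuum_def eigenfunctional_def assms fun_eq_iff)
  moreover have "integrable N (\<lambda>y. eigenfunctional (complex_of_real y) i js)" for i js
    by (auto simp: eigenfunctional_def assms)
  ultimately show ?thesis by (simp add: ev_integral ev_eigenfunctional)
qed

lemma vacuum_sum_moment:
  assumes "\<And>k. integrable M (\<lambda>x. complex_of_real x ^ k)"
    and "\<And>k. m k = (\<integral>x. complex_of_real x ^ k \<partial>M)"
  shows "sum_moment n (vacuum m) = (\<integral>x. sum_moment n (geometric (complex_of_real x)) \<partial>M)"
    and "integrable M (\<lambda>x. sum_moment n (geometric (complex_of_real x)))"
proof -
  have "vacuum m = (\<lambda>i js. \<integral>x. geometric (complex_of_real x) i js \<partial>M)"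
    by (auto simp: vacuum_def geometric_def assms fun_eq_iff)
  moreover have "integrable M (\<lambda>x. geometric (complex_of_real x) i js)" for i js
    by (cases "js = []") (simp_all add: geometric_def assms)
  ultimately show "sum_moment n (vacuum m) = (\<integral>x. sum_moment n (geometric (complex_of_real x)) \<partial>M)"
    "integrable M (\<lambda>x. sum_moment n (geometric (complex_of_real x)))"
    by (simp_all add: sum_moment_def ev_integral)
qed

text \<open>The weight \<open>R ^ (i + sum_list js)\<close> is reproduced by each operator:
  \<open>x\<close> costs a factor \<open>R\<close>, creation 1 and annihilation
  \<open>norm t\<close>.\<close>

lemma norm_sum_moment_le:
  assumes R: "R \<ge> 0" "\<And>i. norm (m i) \<le> R ^ i"
    and f: "\<And>i js. norm (f i js) \<le> B * R ^ (i + sum_list js)"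
  shows "norm (sum_moment n f) \<le> B * (R + 1 + norm t) ^ n"
  using f
proof (induction n arbitrary: f B)
  case 0
  then show ?case using 0[of 0 "[]"] by (simp add: sum_moment_0)
next
  case (Suc n)
  have B: "B \<ge> 0" using order_trans[OF norm_ge_zero Suc.prems[of 0 "[]"]] by simp
  have ann: "norm (annihilate f i js) \<le> norm t * B * R ^ (i + sum_list js)" for i js
  proof (cases js)
    case (Cons j js')
    have "norm (t * m i * f j js') \<le> norm t * R ^ i * (B * R ^ (j + sum_list js'))"
      unfolding norm_mult by (intro mult_mono R Suc.prems) (use R in auto)
    then show ?thesis by (simp add: Cons annihilate_def power_add algebra_simps)
  qed (use B R in \<open>simp add: annihilate_def\<close>)
  have "norm (f_add (act_x f) (act_y f) i js) \<le> B * (R + 1 + norm t) * R ^ (i + sum_list js)" for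
      i js
  proof -
    have "norm (f_add (act_x f) (act_y f) i js)
        \<le> norm (f (Suc i) js) + norm (f 0 (i # js)) + norm (annihilate f i js)"
      unfolding f_add_def act_x_def act_y_def create_def by norm
    also have "\<dots> \<le> B * R ^ (Suc i + sum_list js) + B * R ^ (0 + sum_list (i # js))
        + norm t * B * R ^ (i + sum_list js)"
      by (intro add_mono Suc.prems ann)
    finally show ?thesis by (simp add: algebra_simps)
  qed
  then have "norm (sum_moment n (f_add (act_x f) (act_y f))) \<le> B * (R + 1 + norm t) * (R + 1 +
      norm t) ^ n"
    by (rule Suc.IH)
  then show ?case by (simp add: sum_moment_Suc' mult.assoc)
qed

lemma norm_sum_moment_geometric_le:
  assumes "\<And>i. norm (m i) \<le> R ^ i" "norm x \<le> R"
  shows "norm (sum_moment n (geometric x)) \<le> (R + 1 + norm t) ^ n"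
proof -
  have R: "R \<ge> 0" using assms(2) norm_ge_zero[of x] by linarith
  then have "norm (sum_moment n (geometric x)) \<le> 1 * (R + 1 + norm t) ^ n"
    using assms
    by (intro norm_sum_moment_le) (auto simp: geometric_def norm_power intro: power_mono)
  then show ?thesis by simp
qed

lemma norm_sum_moment_vacuum_le:
  assumes "R \<ge> 0" "\<And>i. norm (m i) \<le> R ^ i"
  shows "norm (sum_moment n (vacuum m)) \<le> (R + 1 + norm t) ^ n"
proof -
  have "norm (sum_moment n (vacuum m)) \<le> 1 * (R + 1 + norm t) ^ n"
    using assms by (intro norm_sum_moment_le) (auto simp: vacuum_def)
  then show ?thesis by simp
qed

lemma sum_moment_in_Reals:
  assumes "t \<in> \<real>" "\<And>i. m i \<in> \<real>" "\<And>i js. f i js \<in> \<real>"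
  shows "sum_moment n f \<in> \<real>"
  using assms(3)
proof (induction n arbitrary: f)
  case (Suc n)
  have "f_add (act_x f) (act_y f) i js \<in> \<real>" for i js
    using Suc.prems assms
    by (auto simp: f_add_def act_x_def act_y_def create_def annihilate_def split: list.splits)
  then show ?case unfolding sum_moment_Suc' by (rule Suc.IH)
qed (simp add: sum_moment_0)

lemma sum_moment_vacuum_in_Reals:
  assumes "t \<in> \<real>" "\<And>i. m i \<in> \<real>"
  shows "sum_moment n (vacuum m) \<in> \<real>"
  by (rule sum_moment_in_Reals) (use assms in \<open>auto simp: vacuum_def\<close>)

end

section \<open>Uniqueness of the free convolution\<close>

lemma compactly_supported_law_integrable_power:
  fixes M :: "real measure"
  assumes "prob_space M" "sets M = sets borel" "AE x in M. \<bar>x\<bar> \<le> R"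
  shows "integrable M (\<lambda>x. x ^ k)"
proof -
  interpret prob_space M by fact
  have "AE x in M. norm (x ^ k) \<le> R ^ k"
    using assms(3) by eventually_elim (auto simp: power_abs intro: power_mono)
  moreover have "(\<lambda>x. x ^ k) \<in> borel_measurable M"
    unfolding measurable_cong_sets[OF assms(2) refl] by measurable
  ultimately show ?thesis by (rule integrable_const_bound)
qed

text \<open>Taylor expansion of the exponential: bounded support bounds the remainder by
  \<open>2 (\<bar>s\<bar> R) ^ n / n!\<close>, so moments determine the characteristic
  function.\<close>

lemma (in real_distribution) char_sums_moments:
  assumes "AE x in M. \<bar>x\<bar> \<le> R"
  shows "(\<lambda>n. \<Sum>k\<le>n. ((\<i> * of_real s) ^ k / fact k) * of_real (expectation (\<lambda>x. x ^ k))) \<longlonglongrightarrow> char M s"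
proof -
  have int: "integrable M (\<lambda>x. x ^ k)" for k
    using assms by (intro compactly_supported_law_integrable_power) (auto simp: prob_space_axioms)
  have bound: "expectation (\<lambda>x. \<bar>x\<bar> ^ n) \<le> R ^ n" for n
  proof -
    have "AE x in M. \<bar>x\<bar> ^ n \<le> R ^ n"
      using assms by eventually_elim (simp add: power_mono)
    then have "expectation (\<lambda>x. \<bar>x\<bar> ^ n) \<le> expectation (\<lambda>x. R ^ n)"
      using int[of n] by (intro integral_mono_AE) (auto simp flip: power_abs)
    then show ?thesis using prob_space by simp
  qed
  have "(\<lambda>n. 2 * ((\<bar>s\<bar> * R) ^ n /\<^sub>R fact n)) \<longlonglongrightarrow> 2 * 0"
    by (intro tendsto_mult tendsto_const summable_LIMSEQ_zero summable_exp_generic)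
  then have lim: "(\<lambda>n. 2 * ((\<bar>s\<bar> * R) ^ n /\<^sub>R fact n)) \<longlonglongrightarrow> 0" by simp
  have "cmod ((\<Sum>k\<le>n. ((\<i> * of_real s) ^ k / fact k) * of_real (expectation (\<lambda>x. x ^ k))) - char M s)
      \<le> 2 * ((\<bar>s\<bar> * R) ^ n /\<^sub>R fact n)" for n
  proof -
    have "cmod (char M s - (\<Sum>k\<le>n. ((\<i> * of_real s) ^ k / fact k) * of_real (expectation (\<lambda>x. x ^
        k))))
      \<le> (2 * \<bar>s\<bar> ^ n / fact n) * expectation (\<lambda>x. \<bar>x\<bar> ^ n)"
      using int by (rule char_approx1)
    also have "\<dots> \<le> (2 * \<bar>s\<bar> ^ n / fact n) * R ^ n"
      by (intro mult_left_mono bound) auto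
    finally show ?thesis by (simp add: norm_minus_commute power_mult_distrib divide_inverse mult_ac)
  qed
  then show ?thesis
    by (intro LIM_zero_cancel[OF Lim_null_comparison[OF _ lim]]) (auto intro: always_eventually)
qed

lemma compactly_supported_law_eqI:
  assumes M: "compactly_supported_law M" and N: "compactly_supported_law N"
    and eq: "\<And>k. (\<integral>x. x ^ k \<partial>M) = (\<integral>x. x ^ k \<partial>N)"
  shows "M = N"
proof (rule Levy_uniqueness)
  show MN: "real_distribution M" "real_distribution N"
    using M N unfolding compactly_supported_law_def
    by (auto simp: real_distribution_def real_distribution_axioms_def)
  obtain R R' where "AE x in M. \<bar>x\<bar> \<le> R" "AE x in N. \<bar>x\<bar> \<le> R'"
    using M N unfolding compactly_supported_law_def by blast
  then show "char M = char N"
    using real_distribution.char_sums_moments[OF MN(1)] real_distribution.char_sums_moments[OF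
        MN(2)]
    unfolding eq by (intro ext LIMSEQ_unique)
qed

lemma is_free_additive_convolution_unique:
  assumes "is_free_additive_convolution M N P" "is_free_additive_convolution M N Q"
  shows "P = Q"
proof -
  obtain \<phi> :: "nc_polynomial \<Rightarrow> complex" and x y where 1: "nc_prob_space nc_scale \<phi>" "free_elements
      nc_scale \<phi> x y"
    "has_law \<phi> x M" "has_law \<phi> y N" "has_law \<phi> (x + y) P"
    using assms(1) unfolding is_free_additive_convolution_def by blast
  obtain \<psi> :: "nc_polynomial \<Rightarrow> complex" and x' y' where 2: "nc_prob_space nc_scale \<psi>"
      "free_elements nc_scale \<psi> x' y'"
    "has_law \<psi> x' M" "has_law \<psi> y' N" "has_law \<psi> (x' + y') Q"
    using assms(2) unfolding is_free_additive_convolution_def by blast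
  interpret two_nc_prob_spaces nc_scale \<phi> nc_scale \<psi> x y x' y'
    using 1 2 by (auto simp: two_nc_prob_spaces_def two_nc_prob_spaces_axioms_def has_law_def)
  show ?thesis
  proof (rule compactly_supported_law_eqI)
    show "(\<integral>x. x ^ k \<partial>P) = (\<integral>x. x ^ k \<partial>Q)" for k
      using sum_power_eq[of k] 1(5) 2(5) by (simp add: has_law_def)
  qed (use 1(5) 2(5) in \<open>auto simp: has_law_def\<close>)
qed

lemma free_additive_convolution_eqI:
  "is_free_additive_convolution M N P \<Longrightarrow> M \<boxplus> N = P"
  unfolding free_additive_convolution_def by (blast intro: is_free_additive_convolution_unique)

section \<open>The semicircle law\<close>

lemma sin_mult_cheb: "sin \<theta> * cheb 1 (2 * cos \<theta>) n = sin (real (Suc n) * \<theta>)"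
proof (induction "1 :: real" "2 * cos \<theta>" n rule: cheb.induct)
  case (3 n)
  have "sin (real (Suc (Suc (Suc n))) * \<theta>) + sin (real (Suc n) * \<theta>)
      = 2 * cos \<theta> * sin (real (Suc (Suc n)) * \<theta>)"
    using sin_plus_sin[of "real (Suc (Suc (Suc n))) * \<theta>" "real (Suc n) * \<theta>"]
    by (simp add: algebra_simps add_divide_distrib)
  with 3 show ?case by (simp add: algebra_simps)
qed (auto simp: sin_double)

lemma cheb_scale: "cheb (c\<^sup>2) (c * s) n = c ^ n * cheb 1 s n" for c s :: "'a::comm_ring_1"
  by (induction "1 :: 'a" s n rule: cheb.induct) (auto simp: algebra_simps power2_eq_square)

lemma cheb_of_real: "cheb 1 (complex_of_real s) n = of_real (cheb 1 s n)"
  by (induction "1 :: real" s n rule: cheb.induct) auto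

lemma continuous_on_cheb [continuous_intros]:
  "continuous_on A (\<lambda>s :: real. cheb 1 s n)"
  by (induction "1 :: real" "0 :: real" n rule: cheb.induct) (auto intro!: continuous_intros)

lemma borel_measurable_cheb [measurable]: "(\<lambda>s :: real. cheb 1 s n) \<in> borel_measurable borel"
  by (intro borel_measurable_continuous_onI continuous_intros)

lemma power2_le_4: "s\<^sup>2 \<le> 4" if "\<bar>s\<bar> \<le> 2" for s :: real
  using that abs_le_square_iff[of s 2] by simp

lemma has_integral_cheb_semicircle:
  "((\<lambda>s. cheb 1 s n * sqrt (4 - s\<^sup>2)) has_integral (if n = 0 then 2 * pi else 0)) {-2..2}"
proof -
  \<comment> \<open>With \<open>s = 2 cos \<theta>\<close> the integrand times \<open>ds\<close>
    becomes \<open>2 cos ((n+2) \<theta>) - 2 cos (n \<theta>)\<close> times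
    \<open>d\<theta>\<close>, and \<open>H\<close> is a primitive. For \<open>n = 0\<close> the
    second cosine is constant; this is where \<open>2 * pi\<close> comes from.\<close>
  define H where "H \<theta> = 2 * sin (real (n + 2) * \<theta>) / real (n + 2)
     - 2 * (if n = 0 then \<theta> else sin (real n * \<theta>) / real n)" for \<theta> :: real
  have H: "(H has_real_derivative (2 * cos (real (n + 2) * \<theta>) - 2 * cos (real n * \<theta>))) (at \<theta>)" for \<theta>
  proof -
    have sin: "((\<lambda>\<theta>. sin (real k * \<theta>) / real k) has_real_derivative cos (real k * \<theta>)) (at \<theta>)"
      if "k > 0" for k :: nat
      using that by (auto intro!: derivative_eq_intros)
    have "((\<lambda>\<theta>. if n = 0 then \<theta> else sin (real n * \<theta>) / real n) has_real_derivative cos (real n *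
        \<theta>)) (at \<theta>)"
      using sin[of n] by (cases "n = 0") auto
    from DERIV_diff[OF DERIV_cmult[OF sin[of "n + 2"], of 2] DERIV_cmult[OF this, of 2]]
    show ?thesis unfolding H_def by simp
  qed
  have "((\<lambda>s. cheb 1 s n * sqrt (4 - s\<^sup>2)) has_integral (H (arccos (2 / 2)) - H (arccos (-2 /
      2)))) {-2..2}"
  proof (rule fundamental_theorem_of_calculus_interior)
    show "continuous_on {-2..2} (\<lambda>s. H (arccos (s / 2)))"
      unfolding H_def by (cases "n = 0") (auto intro!: continuous_intros)
  next
    fix s :: real assume s: "s \<in> {-2<..<2}"
    define \<theta> where "\<theta> = arccos (s / 2)"
    have cos: "s = 2 * cos \<theta>" and pos: "sin \<theta> > 0"
      using s arccos_lt_bounded[of "s / 2"] by (auto simp: \<theta>_def intro!: sin_gt_zero)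
    have "sqrt (4 - s\<^sup>2) = sqrt ((2 * sin \<theta>)\<^sup>2)"
      by (simp add: cos power_mult_distrib sin_squared_eq)
    then have root: "sqrt (4 - s\<^sup>2) = 2 * sin \<theta>" using pos by (simp add: real_sqrt_mult)
    have "((\<lambda>s. arccos (s / 2)) has_real_derivative (- 1 / (2 * sin \<theta>))) (at s)"
      using s by (auto intro!: derivative_eq_intros simp: sin_arccos_abs \<theta>_def field_simps)
    from DERIV_chain2[OF H this[folded \<theta>_def]]
    have "((\<lambda>s. H (arccos (s / 2))) has_real_derivative
       (2 * cos (real (n + 2) * \<theta>) - 2 * cos (real n * \<theta>)) * (- 1 / (2 * sin \<theta>))) (at s)"
      by (simp add: \<theta>_def)
    moreover have "(2 * cos (real (n + 2) * \<theta>) - 2 * cos (real n * \<theta>)) = - 4 * sin \<theta> * sin (real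
        (Suc n) * \<theta>)"
      using cos_diff_cos[of "real (n + 2) * \<theta>" "real n * \<theta>"]
      by (simp add: algebra_simps add_divide_distrib)
    moreover have "cheb 1 s n * sqrt (4 - s\<^sup>2) = 2 * sin (real (Suc n) * \<theta>)"
      unfolding root using sin_mult_cheb[of \<theta> n] by (simp add: cos mult_ac)
    ultimately have "((\<lambda>s. H (arccos (s / 2))) has_real_derivative (cheb 1 s n * sqrt (4 - s\<^sup>2)))
        (at s)"
      using pos by (simp only:) simp
    then show "((\<lambda>s. H (arccos (s / 2))) has_vector_derivative (cheb 1 s n * sqrt (4 - s\<^sup>2))) (at
        s)"
      by (simp add: has_real_derivative_iff_has_vector_derivative)
  qed auto
  moreover have "H (arccos (2 / 2)) - H (arccos (-2 / 2)) = (if n = 0 then 2 * pi else 0)"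
    using sin_npi[of "n + 2"] by (auto simp: H_def simp del: of_nat_add)
  ultimately show ?thesis by simp
qed

lemma sets_semicircle_law [measurable_cong, simp]: "sets semicircle_law = sets borel"
  by (simp add: semicircle_law_def)

lemma prob_space_semicircle_law: "prob_space semicircle_law"
proof
  have "((\<lambda>s. sqrt (4 - s\<^sup>2)) has_integral (2 * pi)) {-2..2}"
    using has_integral_cheb_semicircle[of 0] by simp
  from has_integral_divide[OF this, of "2 * pi"]
  have "((\<lambda>s. sqrt (4 - s\<^sup>2) / (2 * pi)) has_integral 1) {-2..2}" by simp
  then have "integral\<^sup>N lborel (\<lambda>s. ennreal (sqrt (4 - s\<^sup>2) / (2 * pi)) * indicator {-2..2} s) =
      ennreal 1"
    by (intro nn_integral_has_integral_lebesgue') (auto simp: power2_le_4 intro!: divide_nonneg_pos)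
  also have "(\<lambda>s. ennreal (sqrt (4 - s\<^sup>2) / (2 * pi)) * indicator {-2..2} s)
     = (\<lambda>s. ennreal (indicator {-2..2} s * sqrt (4 - s\<^sup>2) / (2 * pi)))"
    by (auto simp: indicator_def)
  finally show "emeasure semicircle_law (space semicircle_law) = 1"
    unfolding semicircle_law_def by (simp add: emeasure_density)
qed

interpretation semicircle: prob_space semicircle_law
  by (rule prob_space_semicircle_law)

lemma AE_semicircle_law: "AE s in semicircle_law. \<bar>s\<bar> \<le> 2"
  unfolding semicircle_law_def by (subst AE_density) (auto simp: indicator_def intro!: AE_I2)

lemma integrable_semicircle_law:
  fixes f :: "real \<Rightarrow> 'a::{banach, second_countable_topology}"
  assumes [measurable]: "f \<in> borel_measurable borel" and "\<And>s. \<bar>s\<bar> \<le> 2 \<Longrightarrow> norm (f s) \<le> B"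
  shows "integrable semicircle_law f"
  using AE_semicircle_law assms
  by (intro semicircle.integrable_const_bound[where B = B]) (auto elim!: eventually_mono)

lemma integral_semicircle_law:
  fixes f :: "real \<Rightarrow> 'a::{banach, second_countable_topology}"
  assumes [measurable]: "f \<in> borel_measurable borel"
  shows "integral\<^sup>L semicircle_law f
    = (\<integral>s. (indicator {-2..2} s * sqrt (4 - s\<^sup>2) / (2 * pi)) *\<^sub>R f s \<partial>lborel)"
  unfolding semicircle_law_def
  by (rule integral_density) (auto simp: power2_le_4 indicator_def intro!: AE_I2 divide_nonneg_pos)

lemma integral_cheb_semicircle_law: "(\<integral>s. cheb 1 s n \<partial>semicircle_law) = (if n = 0 then 1 else 0)"
proof -
  let ?f = "\<lambda>s :: real. cheb 1 s n * sqrt (4 - s\<^sup>2)"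
  have int: "set_integrable lborel {-2..2} ?f"
    by (intro borel_integrable_atLeastAtMost' continuous_intros)
  have "(\<integral>s. cheb 1 s n \<partial>semicircle_law) = (\<integral>s. (indicator {-2..2} s *\<^sub>R ?f s) / (2 * pi) \<partial>lborel)"
    by (subst integral_semicircle_law) (auto intro!: Bochner_Integration.integral_cong)
  also have "\<dots> = integral {-2..2} ?f / (2 * pi)"
    using set_borel_integral_eq_integral(2)[OF int] by (simp add: set_lebesgue_integral_def)
  also have "integral {-2..2} ?f = (if n = 0 then 2 * pi else 0)"
    using has_integral_cheb_semicircle by (rule integral_unique)
  finally show ?thesis by simp
qed

text \<open>Writing \<open>s = c + 1/c\<close> with \<open>c\<close> on the unit circle, \<open>U\<^sub>n\<^sub>+\<^sub>1 = c U\<^sub>n + c\<close> to the power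
    \<open>-(n+1)\<close>.\<close>

lemma abs_cheb_le:
  fixes s :: real
  assumes "\<bar>s\<bar> \<le> 2"
  shows "\<bar>cheb 1 s n\<bar> \<le> real (Suc n)"
proof -
  define c where "c = cis (arccos (s / 2))"
  have c: "c \<noteq> 0" "norm c = 1" by (auto simp: c_def)
  have s: "complex_of_real s = c + inverse c"
    using assms by (auto simp: c_def complex_eq_iff cos_arccos_abs cis_inverse)
  have rec: "cheb 1 (complex_of_real s) (Suc n) = c * cheb 1 (of_real s) n + inverse c ^ Suc n"
      for n
  proof (induction n)
    case (Suc n)
    have "cheb 1 (complex_of_real s) (Suc (Suc n))
        = (c + inverse c) * cheb 1 (of_real s) (Suc n) - cheb 1 (of_real s) n"
      by (simp flip: s)
    also have "\<dots> = c * cheb 1 (of_real s) (Suc n)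
        + inverse c * (cheb 1 (of_real s) (Suc n) - c * cheb 1 (of_real s) n)"
      using c by (simp add: algebra_simps)
    finally show ?case by (simp only: Suc add_diff_cancel_left') simp
  qed (simp add: s)
  have "norm (cheb 1 (complex_of_real s) n) \<le> real (Suc n)"
  proof (induction n)
    case (Suc n)
    have "norm (cheb 1 (complex_of_real s) (Suc n)) \<le> norm (cheb 1 (complex_of_real s) n) + 1"
      unfolding rec by (rule order_trans[OF norm_triangle_ineq])
        (simp add: norm_mult norm_power norm_inverse c)
    then show ?case using Suc by simp
  qed simp
  then show ?thesis by (simp add: cheb_of_real)
qed

text \<open>The three-term recursion, summed, says that series times denominator equals 1, which
  also shows that the denominator is nonzero. Convergence comes from the linear growth of
  \<open>cheb\<close>.\<close>

lemma cheb_generating_function: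
  fixes s :: real and r :: complex
  assumes s: "\<bar>s\<bar> \<le> 2" and r: "norm r < 1"
  shows "summable (\<lambda>n. norm (r ^ n * of_real (cheb 1 s n)))"
    and "1 - r * of_real s + r\<^sup>2 \<noteq> 0"
    and "(suminf (\<lambda>n. r ^ n * of_real (cheb 1 s n))) = 1 / (1 - r * of_real s + r\<^sup>2)"
proof -
  let ?u = "\<lambda>n. r ^ n * of_real (cheb 1 s n)"
  have "summable (\<lambda>n. of_nat (Suc n) * norm r ^ n)"
    using geometric_deriv_sums[of "norm r"] r by (auto simp: sums_iff)
  moreover have "norm (norm (?u n)) \<le> of_nat (Suc n) * norm r ^ n" for n
    using mult_left_mono[OF abs_cheb_le[OF s], of "norm r ^ n" n]
    by (simp add: norm_mult norm_power mult.commute)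
  ultimately show sum: "summable (\<lambda>n. norm (?u n))"
    by (rule summable_comparison_test'[where N = 0])
  then have u: "summable ?u" by (rule summable_norm_cancel)
  have u1: "summable (\<lambda>n. ?u (Suc n))" using u by (subst summable_Suc_iff)
  have "suminf ?u = ?u 0 + ?u 1 + (suminf (\<lambda>n. ?u (Suc (Suc n))))"
    using suminf_split_initial_segment[OF u, of 2] by (simp add: numeral_2_eq_2)
  also have "(\<lambda>n. ?u (Suc (Suc n))) = (\<lambda>n. (r * of_real s) * ?u (Suc n) - r\<^sup>2 * ?u n)"
    by (rule ext) (simp add: algebra_simps power2_eq_square)
  also have "suminf \<dots> = (r * of_real s) * (suminf (\<lambda>n. ?u (Suc n))) - r\<^sup>2 * suminf ?u"
    unfolding suminf_mult[OF u1, symmetric] suminf_mult[OF u, symmetric]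
    by (rule suminf_diff[symmetric]) (intro summable_mult u u1)+
  also have "(suminf (\<lambda>n. ?u (Suc n))) = suminf ?u - 1"
    using suminf_split_head[OF u] by simp
  finally have *: "suminf ?u * (1 - r * of_real s + r\<^sup>2) = 1"
    by (simp add: algebra_simps)
  then show "1 - r * of_real s + r\<^sup>2 \<noteq> 0" by auto
  with * show "suminf ?u = 1 / (1 - r * of_real s + r\<^sup>2)" by (simp add: field_simps)
qed

text \<open>Termwise integration of the series; by orthogonality to constants only the term
  \<open>n = 0\<close> survives.\<close>

lemma integral_generating_function_semicircle:
  fixes r :: complex
  assumes r: "norm r < 1"
  shows "(\<integral>s. 1 / (1 - r * of_real s + r\<^sup>2) \<partial>semicircle_law) = 1"
proof -
  let ?u = "\<lambda>n (s :: real). r ^ n * complex_of_real (cheb 1 s n)"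
  have int: "integrable semicircle_law (?u n)" for n
    by (rule integrable_semicircle_law[where B = "norm r ^ n * real (Suc n)"])
      (auto simp: norm_mult norm_power abs_cheb_le simp del: of_nat_Suc intro!: mult_left_mono)
  have "summable (\<lambda>n. of_nat (Suc n) * norm r ^ n)"
    using geometric_deriv_sums[of "norm r"] r by (auto simp: sums_iff)
  moreover have "(\<integral>s. norm (?u n s) \<partial>semicircle_law) \<le> real (Suc n) * norm r ^ n" for n
  proof -
    have "AE s in semicircle_law. norm (?u n s) \<le> real (Suc n) * norm r ^ n"
      using AE_semicircle_law
      by eventually_elim
        (auto simp: norm_mult norm_power mult.commute[of "norm r ^ _"] abs_cheb_le simp del:
            of_nat_Suc intro!: mult_right_mono)
    then have "(\<integral>s. norm (?u n s) \<partial>semicircle_law) \<le> (\<integral>s. real (Suc n) * norm r ^ n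
        \<partial>semicircle_law)"
      using int by (intro integral_mono_AE) auto
    then show ?thesis by (simp add: semicircle.prob_space)
  qed
  ultimately have sum: "summable (\<lambda>n. \<integral>s. norm (?u n s) \<partial>semicircle_law)"
    by (intro summable_comparison_test[OF _ \<open>summable _\<close>]) auto
  have "AE s in semicircle_law. summable (\<lambda>n. norm (?u n s))"
    using AE_semicircle_law by eventually_elim (rule cheb_generating_function[OF _ r])
  then have "(\<lambda>n. integral\<^sup>L semicircle_law (?u n)) sums (\<integral>s. (suminf (\<lambda>n. ?u n s))
      \<partial>semicircle_law)"
    using int sum by (intro sums_integral)
  moreover have "integral\<^sup>L semicircle_law (?u n) = (if n = 0 then 1 else 0)" for n
    by (simp add: integral_cheb_semicircle_law)
  moreover have "(\<lambda>n. if n = 0 then 1 else 0) sums (1::complex)"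
    using sums_If_finite_set[of "{0}" "\<lambda>_. 1 :: complex"] by simp
  ultimately have "(\<integral>s. (suminf (\<lambda>n. ?u n s)) \<partial>semicircle_law) = 1"
    using sums_unique2 by fastforce
  moreover have "(\<integral>s. (suminf (\<lambda>n. ?u n s)) \<partial>semicircle_law) = (\<integral>s. 1 / (1 - r * of_real s + r\<^sup>2)
      \<partial>semicircle_law)"
    using AE_semicircle_law
    by (intro integral_cong_AE) (auto elim!: eventually_mono simp: cheb_generating_function[OF _ r])
  ultimately show ?thesis by simp
qed

text \<open>Let \<open>r\<close> be a root of \<open>r\<^sup>2 - w r + 1\<close> inside the unit
  disc. Then \<open>w = r + 1 / r\<close> turns \<open>1 / (w - s)\<close> into \<open>r\<close>
  times the generating function, so \<open>g = r\<close>. Such a root exists because the roots have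
  product 1 and sum \<open>w\<close>: both on the unit circle would force
  \<open>norm w \<le> 2\<close>.\<close>

lemma cauchy_transform_semicircle:
  fixes w :: complex
  assumes w: "norm w > 2"
  defines "g \<equiv> (\<integral>s. 1 / (w - of_real s) \<partial>semicircle_law)"
  shows "g\<^sup>2 - w * g + 1 = 0"
proof -
  define d where "d = csqrt (w\<^sup>2 - 4)"
  have d: "d\<^sup>2 = w\<^sup>2 - 4" by (simp add: d_def)
  have "((w - d) / 2) * ((w + d) / 2) = (w\<^sup>2 - d\<^sup>2) / 4"
    by (simp add: field_simps power2_eq_square)
  then have prod: "((w - d) / 2) * ((w + d) / 2) = 1" by (simp add: d)
  have add: "(w - d) / 2 + (w + d) / 2 = w" by (simp add: field_simps)
  have "norm ((w - d) / 2) < 1 \<or> norm ((w + d) / 2) < 1"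
  proof (rule ccontr)
    assume "\<not> ?thesis"
    then have ge: "norm ((w - d) / 2) \<ge> 1" "norm ((w + d) / 2) \<ge> 1" by auto
    have "norm ((w - d) / 2) * norm ((w + d) / 2) = 1" using prod by (metis norm_mult norm_one)
    then have "norm ((w - d) / 2) = 1" "norm ((w + d) / 2) = 1"
      using ge by (smt (verit) mult_le_cancel_left1 mult_le_cancel_right1)+
    then have "norm w \<le> 2" using norm_triangle_ineq[of "(w - d) / 2" "(w + d) / 2"] add by simp
    with w show False by simp
  qed
  then obtain r where r: "norm r < 1" "r\<^sup>2 - w * r + 1 = 0"
  proof
    assume "norm ((w - d) / 2) < 1"
    moreover have "((w - d) / 2)\<^sup>2 - w * ((w - d) / 2) + 1 = (d\<^sup>2 - w\<^sup>2) / 4 + 1"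
      by (simp add: field_simps power2_eq_square)
    then have "((w - d) / 2)\<^sup>2 - w * ((w - d) / 2) + 1 = 0" by (simp add: d)
    ultimately show ?thesis using that by blast
  next
    assume "norm ((w + d) / 2) < 1"
    moreover have "((w + d) / 2)\<^sup>2 - w * ((w + d) / 2) + 1 = (d\<^sup>2 - w\<^sup>2) / 4 + 1"
      by (simp add: field_simps power2_eq_square)
    then have "((w + d) / 2)\<^sup>2 - w * ((w + d) / 2) + 1 = 0" by (simp add: d)
    ultimately show ?thesis using that by blast
  qed
  then have "r \<noteq> 0" by auto
  have "1 / (w - of_real s) = r * (1 / (1 - r * of_real s + r\<^sup>2))" for s
  proof -
    have "1 - r * of_real s + r\<^sup>2 = r * (w - of_real s)" using r(2) by (simp add: algebra_simps)
    then show ?thesis using \<open>r \<noteq> 0\<close> by simp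
  qed
  then have "g = r" unfolding g_def
    by (simp only: integral_mult_right_zero integral_generating_function_semicircle[OF r(1)]) simp
  then show ?thesis using r(2) by simp
qed

section \<open>The Marchenko-Pastur law\<close>

context
  fixes \<gamma> :: real
  assumes gamma_pos: "\<gamma> > 0"
begin

text \<open>The edges of the support correspond to \<open>y = -2\<close> and \<open>y = 2\<close>;
  the factor \<open>sqrt \<gamma>\<close> on the left is the Jacobian of the substitution.\<close>

lemma mp_density_affine:
  "sqrt \<gamma> * mp_density \<gamma> (1 + \<gamma> + sqrt \<gamma> * y)
   = indicator {-2..2} y * sqrt (4 - y\<^sup>2) / (2 * pi) * (1 / (1 + \<gamma> + sqrt \<gamma> * y))"
proof -
  let ?r = "sqrt \<gamma>" and ?k = "1 + \<gamma> + sqrt \<gamma> * y"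
  have r: "?r > 0" "?r * ?r = \<gamma>" using gamma_pos by auto
  have eq: "(1 + ?r)\<^sup>2 - ?k = ?r * (2 - y)" "?k - (1 - ?r)\<^sup>2 = ?r * (2 + y)"
    using r(2) by (simp_all add: power2_eq_square algebra_simps)
  have "?k \<in> {(1 - ?r)\<^sup>2..(1 + ?r)\<^sup>2} \<longleftrightarrow> 0 \<le> ?r * (2 - y) \<and> 0 \<le> ?r * (2 + y)"
    unfolding eq[symmetric] by auto
  also have "\<dots> \<longleftrightarrow> y \<in> {-2..2}" using r by (auto simp: zero_le_mult_iff)
  finally have ind: "indicator {(1 - ?r)\<^sup>2..(1 + ?r)\<^sup>2} ?k = (indicator {-2..2} y :: real)"
    by (simp add: indicator_def)
  have "((1 + ?r)\<^sup>2 - ?k) * (?k - (1 - ?r)\<^sup>2) = \<gamma> * (4 - y\<^sup>2)"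
    unfolding eq using r(2) by (simp add: power2_eq_square algebra_simps)
  then have root: "sqrt (((1 + ?r)\<^sup>2 - ?k) * (?k - (1 - ?r)\<^sup>2)) = ?r * sqrt (4 - y\<^sup>2)"
    by (simp add: real_sqrt_mult)
  have "?r * mp_density \<gamma> ?k = indicator {-2..2} y * (?r * ?r) * sqrt (4 - y\<^sup>2) / (2 * pi * \<gamma> * ?k)"
    unfolding mp_density_def Let_def ind root by simp
  then show ?thesis unfolding r(2) using gamma_pos by simp
qed

lemma mp_density_nonneg: "mp_density \<gamma> x \<ge> 0"
proof (cases "x \<in> {(1 - sqrt \<gamma>)\<^sup>2..(1 + sqrt \<gamma>)\<^sup>2}")
  case True
  moreover from this have "x \<ge> 0" by (meson atLeastAtMost_iff order_trans zero_le_power2)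
  ultimately show ?thesis using gamma_pos by (auto simp: mp_density_def Let_def)
qed (simp add: mp_density_def Let_def)

lemma borel_measurable_mp_density [measurable]: "mp_density \<gamma> \<in> borel_measurable borel"
  unfolding mp_density_def Let_def by measurable

lemma kappa_lower: "\<bar>y\<bar> \<le> 2 \<Longrightarrow> (1 - sqrt \<gamma>)\<^sup>2 \<le> 1 + \<gamma> + sqrt \<gamma> * y"
  using gamma_pos mult_left_mono[of "-2" y "sqrt \<gamma>"] by (simp add: abs_le_iff power2_eq_square
      algebra_simps)

text \<open>The denominator is \<open>1 - r y + r\<^sup>2\<close> with
  \<open>r = - sqrt \<gamma>\<close>. For \<open>\<gamma> > 1\<close> a factor
  \<open>\<gamma>\<close> is taken out first, which replaces \<open>r\<close> by its reciprocal and
  returns it to the unit disc.\<close>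

lemma integral_inverse_semicircle:
  assumes "\<gamma> \<noteq> 1"
  shows "(\<integral>y. 1 / (1 + \<gamma> + sqrt \<gamma> * y) \<partial>semicircle_law) = min 1 (1 / \<gamma>)"
proof -
  have eq: "complex_of_real (\<integral>y. 1 / (1 - r * y + r\<^sup>2) \<partial>semicircle_law) = 1" if "\<bar>r\<bar> < 1" for r ::
      real
    using integral_generating_function_semicircle[of "of_real r"] that
    by (simp flip: integral_complex_of_real)
  show ?thesis
  proof (cases "\<gamma> < 1")
    case True
    then show ?thesis using eq[of "- sqrt \<gamma>"] gamma_pos by (simp add: algebra_simps min_def)
  next
    case False
    then have "\<gamma> > 1" using assms by simp
    have "1 / (1 + \<gamma> + sqrt \<gamma> * y) = (1 / \<gamma>) * (1 / (1 - (- 1 / sqrt \<gamma>) * y + (- 1 / sqrt \<gamma>)\<^sup>2))"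
        for y
    proof -
      have "1 + \<gamma> + sqrt \<gamma> * y = \<gamma> * (1 - (- 1 / sqrt \<gamma>) * y + (- 1 / sqrt \<gamma>)\<^sup>2)"
        using gamma_pos by (simp add: field_simps power_divide real_div_sqrt flip: real_sqrt_mult)
      then show ?thesis by simp
    qed
    then have "(\<integral>y. 1 / (1 + \<gamma> + sqrt \<gamma> * y) \<partial>semicircle_law)
       = 1 / \<gamma> * (\<integral>y. 1 / (1 - (- 1 / sqrt \<gamma>) * y + (- 1 / sqrt \<gamma>)\<^sup>2) \<partial>semicircle_law)"
      by (simp only: integral_mult_right_zero)
    also have "(\<integral>y. 1 / (1 - (- 1 / sqrt \<gamma>) * y + (- 1 / sqrt \<gamma>)\<^sup>2) \<partial>semicircle_law) = 1"
      using eq[of "- 1 / sqrt \<gamma>"] \<open>\<gamma> > 1\<close> of_real_eq_1_iff by fastforce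
    finally show ?thesis using \<open>\<gamma> > 1\<close> by (simp add: min_def)
  qed
qed

text \<open>The mass of the continuous part, complementary to the atom
  \<open>max 0 (1 - 1 / \<gamma>)\<close>. At \<open>\<gamma> = 1\<close> the generating function
  sits on the boundary of its disc and the inverse is unbounded at \<open>y = -2\<close>, so that
  case is integrated by hand.\<close>

lemma nn_integral_inverse_semicircle:
  "(\<integral>\<^sup>+y. ennreal (indicator {-2..2} y * sqrt (4 - y\<^sup>2) / (2 * pi) * (1 / (1 + \<gamma> + sqrt \<gamma> * y)))
      \<partial>lborel)
   = ennreal (min 1 (1 / \<gamma>))"
proof (cases "\<gamma> = 1")
  case False
  have lower: "(1 - sqrt \<gamma>)\<^sup>2 > 0" using False gamma_pos by simp
  then have pos: "1 + \<gamma> + sqrt \<gamma> * y > 0" if "\<bar>y\<bar> \<le> 2" for y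
    using kappa_lower[OF that] by linarith
  have "integrable semicircle_law (\<lambda>y. 1 / (1 + \<gamma> + sqrt \<gamma> * y))"
  proof (rule integrable_semicircle_law)
    show "norm (1 / (1 + \<gamma> + sqrt \<gamma> * y)) \<le> 1 / (1 - sqrt \<gamma>)\<^sup>2" if "\<bar>y\<bar> \<le> 2" for y
      using frac_le[OF _ order_refl lower kappa_lower[OF that], of 1] pos[OF that] by simp
  qed simp
  moreover have "AE y in semicircle_law. 0 \<le> 1 / (1 + \<gamma> + sqrt \<gamma> * y)"
    using AE_semicircle_law by eventually_elim (use pos in \<open>auto intro: less_imp_le\<close>)
  ultimately have "(\<integral>\<^sup>+y. ennreal (1 / (1 + \<gamma> + sqrt \<gamma> * y)) \<partial>semicircle_law) = ennreal (min 1 (1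
      / \<gamma>))"
    using integral_inverse_semicircle[OF False] by (simp add: nn_integral_eq_integral)
  moreover have "ennreal (indicator {-2..2} y * sqrt (4 - y\<^sup>2) / (2 * pi)) * ennreal (1 / (1 + \<gamma> +
      sqrt \<gamma> * y))
      = ennreal (indicator {-2..2} y * sqrt (4 - y\<^sup>2) / (2 * pi) * (1 / (1 + \<gamma> + sqrt \<gamma> * y)))"
          for y
  proof (cases "\<bar>y\<bar> \<le> 2")
    case True
    then show ?thesis using pos[of y] by (intro ennreal_mult''[symmetric]) auto
  qed (auto simp: indicator_def)
  ultimately show ?thesis
    unfolding semicircle_law_def by (subst (asm) nn_integral_density) auto
next
  case True
  \<comment> \<open>A primitive found from \<open>sqrt (4 - y\<^sup>2) / (2 + y) = (2 - y) / sqrt (4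
    - y\<^sup>2)\<close>.\<close>
  define F where "F y = (sqrt (4 - y\<^sup>2) + 2 * arcsin (y / 2)) / (2 * pi)" for y
  have int: "((\<lambda>y. sqrt (4 - y\<^sup>2) / (2 * pi) * (1 / (2 + y))) has_integral (F 2 - F (-2))) {-2..2}"
  proof (rule fundamental_theorem_of_calculus_interior)
    show "continuous_on {-2..2} F" unfolding F_def by (auto intro!: continuous_intros)
  next
    fix y :: real assume y: "y \<in> {-2<..<2}"
    then have "y\<^sup>2 < 4" using power_strict_mono[of "\<bar>y\<bar>" 2 2] by (simp add: abs_less_iff)
    define c where "c = sqrt (4 - y\<^sup>2)"
    have c: "c > 0" "c\<^sup>2 = (2 - y) * (2 + y)" using \<open>y\<^sup>2 < 4\<close> by (auto simp: c_def algebra_simps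
        power2_eq_square)
    have c': "sqrt (1 - (y / 2)\<^sup>2) = c / 2"
    proof -
      have "1 - (y / 2)\<^sup>2 = (4 - y\<^sup>2) / 4" by (simp add: power2_eq_square field_simps)
      then show ?thesis by (simp only: c_def real_sqrt_divide) simp
    qed
    have "(F has_real_derivative (- y / c + 2 / c) / (2 * pi)) (at y)"
      unfolding F_def
      apply (rule derivative_eq_intros refl | use y \<open>y\<^sup>2 < 4\<close> in force)+
      using c by (simp add: c' real_sqrt_divide c_def[symmetric] field_simps)
    moreover have "(- y / c + 2 / c) / (2 * pi) = c / (2 * pi) * (1 / (2 + y))"
    proof -
      have "- y / c + 2 / c = (2 - y) / c" by (simp add: diff_divide_distrib)
      also have "\<dots> = c / (2 + y)" using c y by (simp add: frac_eq_eq power2_eq_square)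
      finally show ?thesis by simp
    qed
    ultimately show "(F has_vector_derivative (sqrt (4 - y\<^sup>2) / (2 * pi) * (1 / (2 + y)))) (at y)"
      by (simp add: has_real_derivative_iff_has_vector_derivative c_def)
  qed simp
  have "integral\<^sup>N lborel (\<lambda>y. indicator {-2..2} y * (sqrt (4 - y\<^sup>2) / (2 * pi) * (1 / (2 + y))))
      = F 2 - F (-2)"
    by (rule nn_integral_has_integral_lebesgue[OF _ int])
      (auto simp: power2_le_4 intro!: divide_nonneg_nonneg)
  also have "F 2 - F (-2) = 1" by (simp add: F_def arcsin_minus)
  finally have "integral\<^sup>N lborel (\<lambda>y. indicator {-2..2} y * (sqrt (4 - y\<^sup>2) / (2 * pi) * (1 / (2
      + y)))) = 1"
    by simp
  then show ?thesis using True by (simp add: mult.assoc)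
qed

lemma nn_integral_mp_density: "(\<integral>\<^sup>+x. ennreal (mp_density \<gamma> x) \<partial>lborel) = ennreal (min 1 (1 / \<gamma>))"
proof -
  have "(\<integral>\<^sup>+x. ennreal (mp_density \<gamma> x) \<partial>lborel)
      = ennreal (sqrt \<gamma>) * (\<integral>\<^sup>+y. ennreal (mp_density \<gamma> (1 + \<gamma> + sqrt \<gamma> * y)) \<partial>lborel)"
    using nn_integral_real_affine[of "\<lambda>x. ennreal (mp_density \<gamma> x)" "sqrt \<gamma>" "1 + \<gamma>"] gamma_pos by
        simp
  also have "\<dots> = (\<integral>\<^sup>+y. ennreal (sqrt \<gamma> * mp_density \<gamma> (1 + \<gamma> + sqrt \<gamma> * y)) \<partial>lborel)"
    using gamma_pos by (simp add: ennreal_mult mp_density_nonneg flip: nn_integral_cmult)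
  finally show ?thesis unfolding mp_density_affine nn_integral_inverse_semicircle .
qed

section \<open>Integration against the Marchenko-Pastur law, including its atom\<close>

abbreviation mp_cont :: "real measure" where
  "mp_cont \<equiv> density lborel (\<lambda>x. ennreal (mp_density \<gamma> x))"

lemma sets_mp [measurable_cong, simp]: "sets (marchenko_pastur_law \<gamma>) = sets borel"
  and space_mp [simp]: "space (marchenko_pastur_law \<gamma>) = UNIV"
  unfolding marchenko_pastur_law_def using sets.sigma_sets_eq[of "borel :: real measure"] by
      simp_all

lemma emeasure_mp:
  assumes "A \<in> sets borel"
  shows "emeasure (marchenko_pastur_law \<gamma>) A
    = emeasure mp_cont A + ennreal (max 0 (1 - 1 / \<gamma>)) * indicator A 0"
proof (rule emeasure_measure_of[OF marchenko_pastur_law_def])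
  let ?c = "ennreal (max 0 (1 - 1 / \<gamma>))"
  show "positive (sets (marchenko_pastur_law \<gamma>)) (\<lambda>A. emeasure mp_cont A + ?c * indicator A 0)"
    by (simp add: positive_def)
  show "countably_additive (sets (marchenko_pastur_law \<gamma>)) (\<lambda>A. emeasure mp_cont A + ?c *
      indicator A 0)"
    unfolding countably_additive_def
  proof (intro allI impI)
    fix A :: "nat \<Rightarrow> real set"
    assume A: "range A \<subseteq> sets (marchenko_pastur_law \<gamma>)" "disjoint_family A"
    have "suminf (\<lambda>i. emeasure mp_cont (A i) + ?c * indicator (A i) 0)
        = suminf (\<lambda>i. emeasure mp_cont (A i)) + ?c * suminf (\<lambda>i. indicator (A i) 0)"
      by (simp add: suminf_add[symmetric] flip: ennreal_suminf_cmult)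
    also have "\<dots> = emeasure mp_cont (\<Union>i. A i) + ?c * indicator (\<Union>i. A i) 0"
      using A by (simp add: suminf_emeasure suminf_indicator)
    finally show "suminf (\<lambda>i. emeasure mp_cont (A i) + ?c * indicator (A i) 0)
       = emeasure mp_cont (\<Union>i. A i) + ?c * indicator (\<Union>i. A i) 0" .
  qed
qed (use assms in auto)

lemma prob_space_mp: "prob_space (marchenko_pastur_law \<gamma>)"
proof
  have "emeasure (marchenko_pastur_law \<gamma>) UNIV = ennreal (min 1 (1 / \<gamma>)) + ennreal (max 0 (1 - 1 /
      \<gamma>))"
    by (simp add: emeasure_mp emeasure_density nn_integral_mp_density)
  also have "\<dots> = ennreal (min 1 (1 / \<gamma>) + max 0 (1 - 1 / \<gamma>))"
    using gamma_pos by (intro ennreal_plus[symmetric]) auto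
  also have "min 1 (1 / \<gamma>) + max 0 (1 - 1 / \<gamma>) = 1" by (simp add: min_def max_def)
  finally show "emeasure (marchenko_pastur_law \<gamma>) (space (marchenko_pastur_law \<gamma>)) = 1" by simp
qed

lemma AE_mp: "AE x in marchenko_pastur_law \<gamma>. \<bar>x\<bar> \<le> (1 + sqrt \<gamma>)\<^sup>2"
proof (rule AE_I')
  let ?N = "{x. \<not> \<bar>x\<bar> \<le> (1 + sqrt \<gamma>)\<^sup>2}"
  have "ennreal (mp_density \<gamma> x) * indicator ?N x = 0" for x
    by (auto simp: mp_density_def Let_def indicator_def dest: order_trans[OF zero_le_power2])
  moreover have "emeasure mp_cont ?N = (\<integral>\<^sup>+x. ennreal (mp_density \<gamma> x) * indicator ?N x \<partial>lborel)"
    by (rule emeasure_density) auto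
  ultimately have "emeasure mp_cont ?N = 0" by (simp only:) simp
  then show "?N \<in> null_sets (marchenko_pastur_law \<gamma>)"
    by (auto simp: null_sets_def emeasure_mp)
qed auto

text \<open>A function vanishing at the possible atom only sees the density.\<close>

lemma integral_mp:
  fixes f :: "real \<Rightarrow> 'a::{banach, second_countable_topology}"
  assumes [measurable]: "f \<in> borel_measurable borel" and "f 0 = 0"
  shows "integral\<^sup>L (marchenko_pastur_law \<gamma>) f
    = (\<integral>y. (1 / (1 + \<gamma> + sqrt \<gamma> * y)) *\<^sub>R f (1 + \<gamma> + sqrt \<gamma> * y) \<partial>semicircle_law)"
proof -
  \<comment> \<open>Deleting the origin removes the atom and otherwise only a Lebesgue null
    set.\<close>
  have "mp_cont = density (marchenko_pastur_law \<gamma>) (indicator (- {0}))"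
  proof (rule measure_eqI)
    fix A assume "A \<in> sets mp_cont"
    then have A[measurable]: "A \<in> sets borel" by simp
    have "emeasure (density (marchenko_pastur_law \<gamma>) (indicator (- {0}))) A
       = emeasure (marchenko_pastur_law \<gamma>) (- {0} \<inter> A)"
      by (rule emeasure_restricted) auto
    also have "\<dots> = emeasure mp_cont (A - {0})"
      by (subst emeasure_mp) (auto simp: Diff_eq Int_commute)
    also have "\<dots> = emeasure mp_cont A"
      by (rule emeasure_Diff_null_set) (auto simp: null_sets_def emeasure_density
          nn_integral_null_set)
    finally show "emeasure mp_cont A = emeasure (density (marchenko_pastur_law \<gamma>) (indicator (-
        {0}))) A" ..
  qed simp
  then have "integral\<^sup>L mp_cont f = integral\<^sup>L (density (marchenko_pastur_law \<gamma>) (\<lambda>x. ennreal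
      (indicator (- {0}) x))) f"
    by (simp add: ennreal_indicator)
  also have "\<dots> = (\<integral>x. indicator (- {0}) x *\<^sub>R f x \<partial>marchenko_pastur_law \<gamma>)"
    by (rule integral_density) auto
  also have "(\<lambda>x. indicator (- {0}) x *\<^sub>R f x) = f" using \<open>f 0 = 0\<close> by (auto simp: indicator_def)
  finally have "integral\<^sup>L (marchenko_pastur_law \<gamma>) f = integral\<^sup>L mp_cont f" ..
  also have "\<dots> = (\<integral>x. mp_density \<gamma> x *\<^sub>R f x \<partial>lborel)"
    by (rule integral_density) (auto simp: mp_density_nonneg)
  also have "\<dots> = sqrt \<gamma> *\<^sub>R (\<integral>y. mp_density \<gamma> (1 + \<gamma> + sqrt \<gamma> * y) *\<^sub>R f (1 + \<gamma> + sqrt \<gamma> * y)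
      \<partial>lborel)"
    using lborel_integral_real_affine[of "sqrt \<gamma>" "\<lambda>x. mp_density \<gamma> x *\<^sub>R f x" "1 + \<gamma>"] gamma_pos
        by simp
  also have "\<dots> = (\<integral>y. (sqrt \<gamma> * mp_density \<gamma> (1 + \<gamma> + sqrt \<gamma> * y)) *\<^sub>R f (1 + \<gamma> + sqrt \<gamma> * y)
      \<partial>lborel)"
    by (simp flip: integral_scaleR_right)
  also have "\<dots> = (\<integral>y. (1 / (1 + \<gamma> + sqrt \<gamma> * y)) *\<^sub>R f (1 + \<gamma> + sqrt \<gamma> * y) \<partial>semicircle_law)"
    unfolding mp_density_affine by (subst integral_semicircle_law) (auto)
  finally show ?thesis .
qed

text \<open>
  \<open>x / (s - x)\<close> vanishes at the atom, and \<open>x = 1 + \<gamma> + sqrt \<gamma> y\<close> turns \<open>x\<close> times the density into a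
  semicircle density, so \<open>s h - 1\<close> is a rescaled Cauchy transform of the semicircle law.
\<close>

lemma cauchy_transform_mp:
  fixes s :: complex
  assumes s: "norm s > (1 + sqrt \<gamma>)\<^sup>2"
  defines "h \<equiv> (\<integral>x. 1 / (s - of_real x) \<partial>marchenko_pastur_law \<gamma>)"
  shows "of_real \<gamma> * s * h\<^sup>2 - (s - 1 + of_real \<gamma>) * h + 1 = 0"
proof -
  interpret prob_space "marchenko_pastur_law \<gamma>" by (rule prob_space_mp)
  have "s \<noteq> 0" using s by auto
  have r: "sqrt \<gamma> > 0" "sqrt \<gamma> * sqrt \<gamma> = \<gamma>" using gamma_pos by auto
  define w where "w = (s - 1 - of_real \<gamma>) / of_real (sqrt \<gamma>)"
  define g where "g = (\<integral>y. 1 / (w - of_real y) \<partial>semicircle_law)"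
  have sw: "s = 1 + of_real \<gamma> + of_real (sqrt \<gamma>) * w" using r by (simp add: w_def)
  \<comment> \<open>Since
    \<open>(1 + sqrt \<gamma>)\<^sup>2 = 1 + \<gamma> + 2 sqrt \<gamma>\<close>, the assumption on
    \<open>s\<close> gives \<open>norm w > 2\<close>.\<close>
  have "norm s \<le> 1 + \<gamma> + sqrt \<gamma> * norm w"
  proof -
    have "norm (1 + complex_of_real \<gamma>) = 1 + \<gamma>"
      using gamma_pos norm_of_real[of "1 + \<gamma>", where 'a = complex] by simp
    then show ?thesis
      unfolding sw using r gamma_pos by (intro order_trans[OF norm_triangle_ineq]) (simp add:
          norm_mult)
  qed
  then have "sqrt \<gamma> * 2 < sqrt \<gamma> * norm w" using s r(2) by (simp add: power2_eq_square
      algebra_simps)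
  then have "norm w > 2" using r by simp
  from cauchy_transform_semicircle[OF this] have g: "g\<^sup>2 - w * g + 1 = 0" by (simp add: g_def)
  have ne: "s \<noteq> of_real x" if "\<bar>x\<bar> \<le> (1 + sqrt \<gamma>)\<^sup>2" for x
    using s that by auto
  have int: "integrable (marchenko_pastur_law \<gamma>) (\<lambda>x. 1 / (s - of_real x))"
  proof (rule integrable_const_bound)
    show "AE x in marchenko_pastur_law \<gamma>. norm (1 / (s - of_real x)) \<le> 1 / (norm s - (1 + sqrt
        \<gamma>)\<^sup>2)"
      using AE_mp
    proof eventually_elim
      case (elim x)
      have "norm s - (1 + sqrt \<gamma>)\<^sup>2 \<le> norm (s - of_real x)"
        using elim norm_triangle_ineq2[of s "of_real x"] by simp
      then show ?case
        using s frac_le[of 1 1 "norm s - (1 + sqrt \<gamma>)\<^sup>2" "norm (s - of_real x)"] by (simp add: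
            norm_divide)
    qed
  qed measurable
  have "s * h = (\<integral>x. s * (1 / (s - of_real x)) \<partial>marchenko_pastur_law \<gamma>)"
    unfolding h_def by (rule integral_mult_right_zero[symmetric])
  also have "\<dots> = (\<integral>x. 1 + of_real x / (s - of_real x) \<partial>marchenko_pastur_law \<gamma>)"
    using AE_mp by (intro integral_cong_AE) (auto elim!: eventually_mono simp: field_simps dest: ne)
  finally have sh: "s * h = (\<integral>x. 1 + of_real x / (s - of_real x) \<partial>marchenko_pastur_law \<gamma>)" .
  have "integrable (marchenko_pastur_law \<gamma>) (\<lambda>x. s * (1 / (s - of_real x)) - 1)"
    by (intro Bochner_Integration.integrable_diff integrable_mult_right int) simp
  moreover have "integrable (marchenko_pastur_law \<gamma>) (\<lambda>x. s * (1 / (s - of_real x)) - 1)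
     \<longleftrightarrow> integrable (marchenko_pastur_law \<gamma>) (\<lambda>x. of_real x / (s - of_real x))"
    using AE_mp by (intro integrable_cong_AE) (auto elim!: eventually_mono simp: field_simps dest:
        ne)
  ultimately have "s * h - 1 = (\<integral>x. of_real x / (s - of_real x) \<partial>marchenko_pastur_law \<gamma>)"
    unfolding sh using prob_space by (subst Bochner_Integration.integral_add) auto
  also have "\<dots> = (\<integral>y. (1 / (1 + \<gamma> + sqrt \<gamma> * y)) *\<^sub>R
     (of_real (1 + \<gamma> + sqrt \<gamma> * y) / (s - of_real (1 + \<gamma> + sqrt \<gamma> * y))) \<partial>semicircle_law)"
    by (rule integral_mp) auto
  also have "\<dots> = (\<integral>y. 1 / of_real (sqrt \<gamma>) * (1 / (w - of_real y)) \<partial>semicircle_law)"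
  proof (rule integral_cong_AE)
    \<comment> \<open>The cancelled factor vanishes at this one point, which lies in
      \<open>[-2, 2]\<close> only for \<open>\<gamma> = 1\<close>; there division by zero would
      spoil the pointwise identity.\<close>
    have "AE y in lborel. y \<noteq> - (1 + \<gamma>) / sqrt \<gamma>" by (rule AE_lborel_singleton)
    then have "AE y in semicircle_law. y \<noteq> - (1 + \<gamma>) / sqrt \<gamma>"
      unfolding semicircle_law_def by (subst AE_density) auto
    then show "AE y in semicircle_law. (1 / (1 + \<gamma> + sqrt \<gamma> * y)) *\<^sub>R
     (of_real (1 + \<gamma> + sqrt \<gamma> * y) / (s - of_real (1 + \<gamma> + sqrt \<gamma> * y)))
       = 1 / of_real (sqrt \<gamma>) * (1 / (w - of_real y))"
    proof eventually_elim
      case (elim y)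
      then have "1 + \<gamma> + sqrt \<gamma> * y \<noteq> 0" using r by (auto simp: field_simps)
      then have "(1 / (1 + \<gamma> + sqrt \<gamma> * y)) *\<^sub>R
        (of_real (1 + \<gamma> + sqrt \<gamma> * y) / (s - of_real (1 + \<gamma> + sqrt \<gamma> * y)))
        = 1 / (s - of_real (1 + \<gamma> + sqrt \<gamma> * y))"
        unfolding scaleR_conv_of_real times_divide_eq_right of_real_mult[symmetric] by simp
      moreover have d: "s - of_real (1 + \<gamma> + sqrt \<gamma> * y) = of_real (sqrt \<gamma>) * (w - of_real y)"
        by (simp add: sw algebra_simps)
      ultimately show ?case unfolding d by simp
    qed
  qed auto
  also have "\<dots> = g / of_real (sqrt \<gamma>)" unfolding g_def by (subst integral_mult_right_zero) simp
  finally have "g = of_real (sqrt \<gamma>) * (s * h - 1)" using r by simp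
  with g have "(of_real (sqrt \<gamma>) * (s * h - 1))\<^sup>2 - (of_real (sqrt \<gamma>) * w) * (s * h - 1) + 1 = 0"
    by (simp add: mult_ac)
  moreover have "(complex_of_real (sqrt \<gamma>))\<^sup>2 = of_real \<gamma>" using r by (simp add: power2_eq_square
      flip: of_real_mult)
  moreover have "of_real (sqrt \<gamma>) * w = s - 1 - of_real \<gamma>" using r by (simp add: w_def)
  ultimately have "of_real \<gamma> * (s * h - 1)\<^sup>2 - (s - 1 - of_real \<gamma>) * (s * h - 1) + 1 = 0"
    by (simp add: power_mult_distrib)
  then have "s * (of_real \<gamma> * s * h\<^sup>2 - (s - 1 + of_real \<gamma>) * h + 1) = 0"
    by (simp add: algebra_simps power2_eq_square)
  with \<open>s \<noteq> 0\<close> show ?thesis by simp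
qed

text \<open>The third claim is the R-transform of \<open>a (y - 1)\<close>: it says
  \<open>\<omega> = 1 / G + a / (1 - a \<gamma> G) - a\<close>. For \<open>a = 0\<close> the law is
  a point mass at 0 and \<open>G = 1 / \<omega>\<close>; this case is separate because
  \<open>s\<close> is obtained by dividing by \<open>a\<close>.\<close>

lemma cauchy_transform_scaled_mp:
  fixes a :: real and \<omega> :: complex
  assumes \<omega>: "norm \<omega> > \<bar>a\<bar> * ((1 + sqrt \<gamma>)\<^sup>2 + 1)"
  defines "G \<equiv> (\<integral>x. 1 / (\<omega> - of_real x) \<partial>distr (marchenko_pastur_law \<gamma>) borel (\<lambda>y. a * (y - 1)))"
  shows "G \<noteq> 0" and "1 - of_real (a * \<gamma>) * G \<noteq> 0"
    and "1 / G = \<omega> + of_real a - of_real a / (1 - of_real (a * \<gamma>) * G)"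
proof -
  interpret prob_space "marchenko_pastur_law \<gamma>" by (rule prob_space_mp)
  have G: "G = (\<integral>y. 1 / (\<omega> - of_real (a * (y - 1))) \<partial>marchenko_pastur_law \<gamma>)"
    unfolding G_def by (rule integral_distr) auto
  have "G \<noteq> 0 \<and> 1 - of_real (a * \<gamma>) * G \<noteq> 0 \<and> 1 / G = \<omega> + of_real a - of_real a / (1 - of_real (a
      * \<gamma>) * G)"
  proof (cases "a = 0")
    case True
    then show ?thesis using \<omega> prob_space by (auto simp: G)
  next
    case False
    define s where "s = \<omega> / of_real a + 1"
    define h where "h = (\<integral>x. 1 / (s - of_real x) \<partial>marchenko_pastur_law \<gamma>)"
    have \<omega>s: "\<omega> = of_real a * (s - 1)" using False by (simp add: s_def)
    have "norm \<omega> \<le> \<bar>a\<bar> * (norm s + 1)"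
      unfolding \<omega>s norm_mult norm_of_real using norm_triangle_ineq4[of s 1] by (intro
          mult_left_mono) auto
    with \<omega> have "\<bar>a\<bar> * ((1 + sqrt \<gamma>)\<^sup>2 + 1) < \<bar>a\<bar> * (norm s + 1)" by simp
    then have "norm s > (1 + sqrt \<gamma>)\<^sup>2" using False by simp
    from cauchy_transform_mp[OF this]
    have h: "of_real \<gamma> * s * h\<^sup>2 - (s - 1 + of_real \<gamma>) * h + 1 = 0" by (simp add: h_def)
    have "1 / (\<omega> - of_real (a * (y - 1))) = 1 / of_real a * (1 / (s - of_real y))" for y
    proof -
      have "\<omega> - of_real (a * (y - 1)) = of_real a * (s - of_real y)" by (simp add: \<omega>s algebra_simps)
      then show ?thesis by simp
    qed
    then have Gh: "G = h / of_real a"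
      unfolding G h_def by (simp only: integral_mult_right_zero) simp
    have "h \<noteq> 0" using h by auto
    \<comment> \<open>The quadratic equation, factored so that \<open>1 / h\<close> can be solved
      for.\<close>
    have fac: "(1 - of_real \<gamma> * h) * (h * s - 1) = h"
      using h by (simp add: algebra_simps power2_eq_square)
    then have ne: "1 - of_real \<gamma> * h \<noteq> 0" using \<open>h \<noteq> 0\<close> by auto
    have "1 / G = of_real a * (1 / h)" using Gh by simp
    also have "1 / h = s - 1 / (1 - of_real \<gamma> * h)"
      using fac ne \<open>h \<noteq> 0\<close> by (simp add: field_simps)
    finally have "1 / G = \<omega> + of_real a - of_real a / (1 - of_real \<gamma> * h)"
      by (simp add: \<omega>s algebra_simps)
    moreover have "of_real (a * \<gamma>) * G = of_real \<gamma> * h" using False by (simp add: Gh)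
    ultimately show ?thesis using ne \<open>h \<noteq> 0\<close> Gh False by simp
  qed
  then show "G \<noteq> 0" "1 - of_real (a * \<gamma>) * G \<noteq> 0"
    "1 / G = \<omega> + of_real a - of_real a / (1 - of_real (a * \<gamma>) * G)" by blast+
qed

end

section \<open>Moments from the Stieltjes transform\<close>

text \<open>
  Only the values high up on the imaginary axis are used. Even moments exist by monotone
  convergence as \<open>y\<close> grows, and odd ones are then read off by dominated convergence.
\<close>

locale stieltjes_expansion = prob_space \<mu>
  for \<mu> :: "real measure" +
  fixes c :: "nat \<Rightarrow> real" and K Y :: real
  assumes sets_mu [measurable_cong]: "sets \<mu> = sets borel"
    and c_0: "c 0 = 1"
    and c_bound: "\<bar>c n\<bar> \<le> K ^ n" and K_nonneg: "K \<ge> 0"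
    and Y: "Y > 0" "Y > K"
    and expansion: "y \<ge> Y \<Longrightarrow> (\<integral>x. 1 / (of_real x - \<i> * of_real y) \<partial>\<mu>)
      = - (suminf (\<lambda>n. of_real (c n) * (1 / (\<i> * of_real y)) ^ Suc n))"
begin

text \<open>The remainder of the moment series after \<open>n\<close> terms, divided by
  \<open>z ^ n\<close>, so that it tends to \<open>c n\<close> at 0.\<close>

definition tail :: "nat \<Rightarrow> complex \<Rightarrow> complex" where
  "tail n z = suminf (\<lambda>j. of_real (c (n + j)) * z ^ j)"

lemma summable_tail:
  assumes "norm z * K < 1"
  shows "summable (\<lambda>j. complex_of_real (c (n + j)) * z ^ j)"
proof -
  have "summable (\<lambda>j. K ^ n * (norm z * K) ^ j)"
    using assms K_nonneg by (intro summable_mult summable_geometric) simp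
  moreover have "norm (complex_of_real (c (n + j)) * z ^ j) \<le> K ^ n * (norm z * K) ^ j" for j
    using mult_right_mono[OF c_bound[of "n + j"], of "norm z ^ j"]
    by (simp add: norm_mult norm_power power_add power_mult_distrib mult_ac)
  ultimately show ?thesis by (rule summable_comparison_test'[where N = 0])
qed

lemma tail_Suc:
  assumes "norm z * K < 1"
  shows "tail n z = of_real (c n) + z * tail (Suc n) z"
proof -
  have "tail n z = of_real (c n) + suminf (\<lambda>j. of_real (c (n + Suc j)) * z ^ Suc j)"
    using suminf_split_head[OF summable_tail[OF assms, of n]] by (simp add: tail_def)
  also have "suminf (\<lambda>j. of_real (c (n + Suc j)) * z ^ Suc j) = suminf (\<lambda>j. z * (of_real (c (Suc n
      + j)) * z ^ j))"
    by (simp add: mult_ac)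
  also have "\<dots> = z * tail (Suc n) z"
    unfolding tail_def by (rule suminf_mult[OF summable_tail[OF assms]])
  finally show ?thesis .
qed

lemma tail_tendsto: "(tail n \<longlongrightarrow> of_real (c n)) (at 0)"
proof -
  have "(\<lambda>j. complex_of_real (c (n + j)) * z ^ j) sums tail n z" if z: "norm z < 1 / (K + 1)" for z
  proof -
    have "norm z * K \<le> norm z * (K + 1)" by (intro mult_left_mono) auto
    also have "\<dots> < 1" using z K_nonneg by (simp add: field_simps)
    finally show ?thesis unfolding tail_def by (intro summable_sums summable_tail)
  qed
  then show ?thesis
    using powser_limit_0[of "1 / (K + 1)" "\<lambda>j. complex_of_real (c (n + j))" "tail n"] K_nonneg by
        simp
qed

definition ys :: "nat \<Rightarrow> real" where "ys k = Y + real k"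
definition zs :: "nat \<Rightarrow> complex" where "zs k = 1 / (\<i> * of_real (ys k))"

lemma ys_pos: "ys k > 0" and ys_ge: "ys k \<ge> Y" and ys_gt: "ys k > K"
  using Y by (auto simp: ys_def)

lemma norm_zs: "norm (zs k) * K < 1"
  using ys_pos[of k] ys_gt[of k] by (simp add: zs_def norm_divide norm_mult)

lemma ys_tendsto: "filterlim ys at_top sequentially"
  unfolding ys_def by (intro filterlim_tendsto_add_at_top[OF tendsto_const]
      filterlim_real_sequentially)

lemma zs_tendsto: "filterlim zs (at 0) sequentially"
proof (rule filterlim_atI)
  have "(\<lambda>k. norm (zs k)) = (\<lambda>k. inverse (ys k))"
    using ys_pos by (auto simp: zs_def norm_divide norm_mult inverse_eq_divide abs_of_pos)
  moreover have "(\<lambda>k. inverse (ys k)) \<longlonglongrightarrow> 0"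
    by (rule tendsto_inverse_0_at_top[OF ys_tendsto])
  ultimately have "(\<lambda>k. norm (zs k)) \<longlonglongrightarrow> 0" by simp
  then show "zs \<longlonglongrightarrow> 0" by (rule tendsto_norm_zero_cancel)
  show "eventually (\<lambda>k. zs k \<noteq> 0) sequentially"
    by (intro always_eventually) (auto simp: zs_def ys_pos[THEN less_imp_neq, symmetric])
qed

lemma tail_zs: "(\<lambda>k. tail n (zs k)) \<longlonglongrightarrow> of_real (c n)"
  by (rule filterlim_compose[OF tail_tendsto zs_tendsto])

definition resolvent :: "nat \<Rightarrow> nat \<Rightarrow> real \<Rightarrow> complex" where
  "resolvent n k x = of_real x ^ n / (of_real x - \<i> * of_real (ys k))"

lemma borel_measurable_resolvent [measurable]: "resolvent n k \<in> borel_measurable borel"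
  unfolding resolvent_def by measurable

text \<open>The expansion with its first \<open>n\<close> terms removed, kept exact rather than
  asymptotic. Integrability is part of the claim because finiteness of moments is not known
  beforehand.\<close>

definition expansion_at :: "nat \<Rightarrow> bool" where
  "expansion_at n \<longleftrightarrow> (\<forall>k. integrable \<mu> (resolvent n k)
     \<and> integral\<^sup>L \<mu> (resolvent n k) = - zs k * tail n (zs k))"

definition moment_at :: "nat \<Rightarrow> bool" where
  "moment_at n \<longleftrightarrow> integrable \<mu> (\<lambda>x. x ^ n) \<and> expectation (\<lambda>x. x ^ n) = c n"

lemma measurable_mu [simp]: "f \<in> borel_measurable \<mu> \<longleftrightarrow> f \<in> borel_measurable borel"
  by (rule arg_cong[where f = "\<lambda>M. f \<in> M"], rule measurable_cong_sets) (auto simp: sets_mu)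

lemma denominator_nonzero: "complex_of_real x - \<i> * of_real (ys k) \<noteq> 0"
  using ys_pos[of k] by (auto simp: complex_eq_iff)

lemma norm_denominator: "ys k \<le> norm (complex_of_real x - \<i> * of_real (ys k))"
  using abs_Im_le_cmod[of "complex_of_real x - \<i> * of_real (ys k)"] ys_pos[of k] by simp

lemma expansion_at_0: "expansion_at 0"
  unfolding expansion_at_def
proof (intro allI conjI)
  fix k
  show "integrable \<mu> (resolvent 0 k)"
  proof (rule integrable_const_bound)
    show "AE x in \<mu>. norm (resolvent 0 k x) \<le> 1 / ys k"
      using frac_le[OF zero_le_one order_refl ys_pos norm_denominator]
      by (intro AE_I2) (simp add: resolvent_def norm_divide)
  qed simp
  have "integral\<^sup>L \<mu> (resolvent 0 k) = - (suminf (\<lambda>n. of_real (c n) * zs k ^ Suc n))"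
    using expansion[OF ys_ge[of k]] by (simp add: resolvent_def[abs_def] zs_def)
  also have "suminf (\<lambda>n. of_real (c n) * zs k ^ Suc n) = suminf (\<lambda>n. zs k * (of_real (c (0 + n)) *
      zs k ^ n))"
    by (simp add: mult_ac)
  also have "\<dots> = zs k * tail 0 (zs k)"
    unfolding tail_def by (rule suminf_mult[OF summable_tail[OF norm_zs]])
  finally show "integral\<^sup>L \<mu> (resolvent 0 k) = - zs k * tail 0 (zs k)" by simp
qed

text \<open>With \<open>w = \<i> * ys k\<close>,
  \<open>x ^ (n+1) / (x - w) = x ^ n + w * x ^ n / (x - w)\<close>; integrating the first term
  strips \<open>c n\<close> from the tail.\<close>

lemma expansion_at_Suc:
  assumes "expansion_at n" "moment_at n"
  shows "expansion_at (Suc n)"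
  unfolding expansion_at_def
proof (intro allI conjI)
  fix k
  have eq: "resolvent (Suc n) k = (\<lambda>x. of_real (x ^ n) + \<i> * of_real (ys k) * resolvent n k x)"
    using denominator_nonzero[of _ k] by (auto simp: resolvent_def fun_eq_iff field_simps)
  have int: "integrable \<mu> (\<lambda>x. complex_of_real (x ^ n))" "integrable \<mu> (resolvent n k)"
    using assms by (auto simp: expansion_at_def moment_at_def simp del: of_real_power)
  then show "integrable \<mu> (resolvent (Suc n) k)" unfolding eq by simp
  have "zs k \<noteq> 0" "\<i> * of_real (ys k) = 1 / zs k" using ys_pos[of k] by (auto simp: zs_def)
  moreover have "integral\<^sup>L \<mu> (resolvent (Suc n) k)
    = of_real (c n) + \<i> * of_real (ys k) * integral\<^sup>L \<mu> (resolvent n k)"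
    unfolding eq using int assms(2)
    by (subst Bochner_Integration.integral_add) (auto simp: moment_at_def simp del: of_real_power)
  ultimately show "integral\<^sup>L \<mu> (resolvent (Suc n) k) = - zs k * tail (Suc n) (zs k)"
    using assms(1) tail_Suc[OF norm_zs, of n k] by (simp add: expansion_at_def)
qed

text \<open>The functions \<open>x ^ (n+2) * y\<^sup>2 / (x\<^sup>2 + y\<^sup>2)\<close> increase to
  \<open>x ^ (n+2)\<close> as \<open>y\<close> grows. They are \<open>y\<^sup>2\<close> times a real
  part of the resolvent. In the expansion the term with \<open>c (n+1)\<close> is purely imaginary
  and drops out, and the next coefficient appears in the limit.\<close>

lemma even_moment_at:
  assumes "expansion_at (Suc n)" "even n"
  shows "moment_at (Suc (Suc n))"
proof -
  let ?f = "\<lambda>k x. (ys k)\<^sup>2 * Re (resolvent (Suc n) k x)"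
  have f: "?f k x = x ^ Suc (Suc n) * ((ys k)\<^sup>2 / (x\<^sup>2 + (ys k)\<^sup>2))" for k x
    by (simp add: resolvent_def Re_divide power2_eq_square flip: of_real_power)
  have pos: "x ^ Suc (Suc n) \<ge> 0" for x :: real using assms(2) by (intro zero_le_even_power) auto
  have int: "integrable \<mu> (resolvent (Suc n) k)"
    and eq: "integral\<^sup>L \<mu> (resolvent (Suc n) k) = - zs k * tail (Suc n) (zs k)" for k
    using assms(1) by (auto simp: expansion_at_def)
  have mono: "mono (\<lambda>k. ?f k x)" for x
    unfolding f
  proof (intro monoI mult_left_mono pos)
    fix k l :: nat assume "k \<le> l"
    then have "ys k \<le> ys l" by (simp add: ys_def)
    then have le: "(ys k)\<^sup>2 \<le> (ys l)\<^sup>2" using ys_pos[of k] by (intro power_mono) auto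
    have "x\<^sup>2 * (ys k)\<^sup>2 \<le> x\<^sup>2 * (ys l)\<^sup>2" using le by (intro mult_left_mono) auto
    moreover have "x\<^sup>2 + (ys k)\<^sup>2 > 0" "x\<^sup>2 + (ys l)\<^sup>2 > 0"
      using ys_pos[of k] ys_pos[of l] by (auto intro!: add_nonneg_pos)
    ultimately show "(ys k)\<^sup>2 / (x\<^sup>2 + (ys k)\<^sup>2) \<le> (ys l)\<^sup>2 / (x\<^sup>2 + (ys l)\<^sup>2)"
      by (simp add: pos_divide_le_eq pos_le_divide_eq algebra_simps)
  qed
  have lim: "(\<lambda>k. ?f k x) \<longlonglongrightarrow> x ^ Suc (Suc n)" for x
  proof -
    have "(\<lambda>k. inverse (ys k)) \<longlonglongrightarrow> 0" by (rule tendsto_inverse_0_at_top[OF ys_tendsto])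
    then have "(\<lambda>k. x ^ Suc (Suc n) * (1 / (x\<^sup>2 * (inverse (ys k))\<^sup>2 + 1))) \<longlonglongrightarrow> x ^ Suc (Suc n) * (1
        / (x\<^sup>2 * 0\<^sup>2 + 1))"
      by (intro tendsto_intros) auto
    moreover have "(ys k)\<^sup>2 / (x\<^sup>2 + (ys k)\<^sup>2) = 1 / (x\<^sup>2 * (inverse (ys k))\<^sup>2 + 1)" for k
      using ys_pos[of k] by (simp add: field_simps)
    ultimately show ?thesis unfolding f by simp
  qed
  have "integral\<^sup>L \<mu> (?f k) = Re (tail (Suc (Suc n)) (zs k))" for k
  proof -
    have "integral\<^sup>L \<mu> (?f k) = (ys k)\<^sup>2 * Re (integral\<^sup>L \<mu> (resolvent (Suc n) k))"
      using int by simp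
    also have "\<dots> = (ys k)\<^sup>2 * Re (- zs k * (of_real (c (Suc n)) + zs k * tail (Suc (Suc n)) (zs
        k)))"
      unfolding eq by (subst tail_Suc[OF norm_zs]) simp
    also have "- zs k * (of_real (c (Suc n)) + zs k * tail (Suc (Suc n)) (zs k))
        = \<i> * of_real (c (Suc n) / ys k) + of_real (1 / (ys k)\<^sup>2) * tail (Suc (Suc n)) (zs k)"
    proof -
      have zs: "zs k = - \<i> * of_real (1 / ys k)" using ys_pos[of k] by (simp add: zs_def
          field_simps)
      have "- z * (u + z * T) = \<i> * of_real (c (Suc n) / ys k) + of_real (1 / (ys k)\<^sup>2) * T"
        if "z = - \<i> * of_real (1 / ys k)" "u = of_real (c (Suc n))" for z u T
        unfolding that by (simp add: algebra_simps power2_eq_square)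
      then show ?thesis using zs by blast
    qed
    also have "Re \<dots> = (1 / (ys k)\<^sup>2) * Re (tail (Suc (Suc n)) (zs k))" by simp
    finally show ?thesis using ys_pos[of k] by simp
  qed
  moreover have "(\<lambda>k. Re (tail (Suc (Suc n)) (zs k))) \<longlonglongrightarrow> c (Suc (Suc n))"
    using tendsto_Re[OF tail_zs[of "Suc (Suc n)"]] by simp
  ultimately have "(\<lambda>k. integral\<^sup>L \<mu> (?f k)) \<longlonglongrightarrow> c (Suc (Suc n))" by simp
  then have "has_bochner_integral \<mu> (\<lambda>x. x ^ Suc (Suc n)) (c (Suc (Suc n)))"
    using int mono lim by (intro has_bochner_integral_monotone_convergence[of \<mu> ?f]) auto
  then show ?thesis by (simp add: moment_at_def has_bochner_integral_iff)
qed

text \<open>Integrability is borrowed from the next even moment. Then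
  \<open>-\<i> y x ^ (n+1) / (x - \<i> y)\<close> tends to \<open>x ^ (n+1)\<close> and is dominated
  by its modulus, as \<open>y \<le> norm (x - \<i> y)\<close>.\<close>

lemma odd_moment_at:
  assumes "expansion_at (Suc n)" "moment_at (Suc (Suc n))" "even n"
  shows "moment_at (Suc n)"
proof -
  have le: "\<bar>x ^ Suc n\<bar> \<le> 1 + x ^ Suc (Suc n)" for x :: real
  proof (cases "\<bar>x\<bar> \<le> 1")
    case True
    then have "\<bar>x\<bar> ^ Suc n \<le> 1" by (intro power_le_one) auto
    moreover have "x ^ Suc (Suc n) \<ge> 0" using assms(3) by (intro zero_le_even_power) auto
    ultimately show ?thesis by (simp add: power_abs del: power_Suc)
  next
    case False
    then have "\<bar>x\<bar> ^ Suc n \<le> \<bar>x\<bar> ^ Suc (Suc n)" by (intro power_increasing) auto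
    also have "\<dots> = x ^ Suc (Suc n)" using assms(3) by (simp add: power_even_abs del: power_Suc)
    finally show ?thesis by (simp add: power_abs del: power_Suc)
  qed
  have int: "integrable \<mu> (\<lambda>x. x ^ Suc n)"
  proof (rule Bochner_Integration.integrable_bound)
    show "integrable \<mu> (\<lambda>x. 1 + x ^ Suc (Suc n))" using assms(2) by (simp add: moment_at_def del:
        power_Suc)
    show "AE x in \<mu>. norm (x ^ Suc n) \<le> norm (1 + x ^ Suc (Suc n))"
      using le by (auto simp del: power_Suc intro: order_trans[OF _ abs_ge_self])
  qed simp
  have "(\<lambda>k. \<integral>x. - \<i> * of_real (ys k) * resolvent (Suc n) k x \<partial>\<mu>) \<longlonglongrightarrow> (\<integral>x. complex_of_real (x ^ Suc
      n) \<partial>\<mu>)"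
  proof (rule integral_dominated_convergence[where w = "\<lambda>x. \<bar>x ^ Suc n\<bar>"])
    show "AE x in \<mu>. (\<lambda>k. - \<i> * of_real (ys k) * resolvent (Suc n) k x) \<longlonglongrightarrow> complex_of_real (x ^ Suc
        n)"
    proof (rule AE_I2)
      fix x :: real
      have "zs \<longlonglongrightarrow> 0" using zs_tendsto by (simp add: filterlim_at)
      then have "(\<lambda>k. complex_of_real (x ^ Suc n) / (1 - of_real x * zs k)) \<longlonglongrightarrow> complex_of_real (x ^
          Suc n) / (1 - of_real x * 0)"
        by (intro tendsto_intros) auto
      moreover have "- \<i> * of_real (ys k) * resolvent (Suc n) k x = complex_of_real (x ^ Suc n) /
          (1 - of_real x * zs k)" for k
      proof -
        have i: "\<i> * complex_of_real (ys k) \<noteq> 0" using ys_pos[of k] by simp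
        have "complex_of_real x - \<i> * of_real (ys k) = - (\<i> * of_real (ys k)) * (1 - of_real x *
            zs k)"
          unfolding zs_def using i by (simp add: right_diff_distrib)
        then show ?thesis unfolding resolvent_def using i by simp
      qed
      ultimately show "(\<lambda>k. - \<i> * of_real (ys k) * resolvent (Suc n) k x) \<longlonglongrightarrow> complex_of_real (x ^
          Suc n)"
        by simp
    qed
    show "AE x in \<mu>. norm (- \<i> * of_real (ys k) * resolvent (Suc n) k x) \<le> \<bar>x ^ Suc n\<bar>" for k
    proof (rule AE_I2)
      fix x
      have "ys k / norm (complex_of_real x - \<i> * of_real (ys k)) \<le> 1"
        using norm_denominator[of k x] ys_pos[of k] by (simp add: divide_le_eq_1)
      then have "\<bar>x\<bar> ^ Suc n * (ys k / norm (complex_of_real x - \<i> * of_real (ys k))) \<le> \<bar>x\<bar> ^ Suc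
          n * 1"
        by (intro mult_left_mono) auto
      then show "norm (- \<i> * of_real (ys k) * resolvent (Suc n) k x) \<le> \<bar>x ^ Suc n\<bar>"
        using ys_pos[of k] by (simp add: resolvent_def norm_mult norm_divide norm_power power_abs
            abs_mult mult_ac)
    qed
  qed (use int in \<open>auto simp: resolvent_def simp del: power_Suc of_real_power\<close>)
  moreover have "(\<integral>x. - \<i> * of_real (ys k) * resolvent (Suc n) k x \<partial>\<mu>) = tail (Suc n) (zs k)" for k
  proof -
    have "(\<integral>x. - \<i> * of_real (ys k) * resolvent (Suc n) k x \<partial>\<mu>) = - \<i> * of_real (ys k) * (- zs k *
        tail (Suc n) (zs k))"
      using assms(1) unfolding expansion_at_def by (subst integral_mult_right_zero) simp
    then show ?thesis using ys_pos[of k] by (simp add: zs_def)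
  qed
  ultimately have "(\<lambda>k. tail (Suc n) (zs k)) \<longlonglongrightarrow> of_real (expectation (\<lambda>x. x ^ Suc n))"
    by (simp only: integral_complex_of_real)
  from LIMSEQ_unique[OF this tail_zs] show ?thesis
    using int by (simp add: moment_at_def del: power_Suc)
qed

text \<open>Moments arrive in the order 0, 2, 1, 4, 3, and so on: an odd moment rests on the next
  even one, while the expansion two orders further needs the odd one.\<close>

lemma moment_at_all: "moment_at n"
proof -
  have "expansion_at (2 * k) \<and> moment_at (2 * k) \<and> moment_at (Suc (2 * k))" for k
  proof (induction k)
    case 0
    have "moment_at 0" using prob_space by (simp add: moment_at_def c_0)
    then show ?case
      using expansion_at_0 expansion_at_Suc[of 0] even_moment_at[of 0] odd_moment_at[of 0] by simp
  next
    case (Suc k)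
    let ?n = "2 * k"
    have 1: "expansion_at (Suc ?n)" using Suc expansion_at_Suc by blast
    then have "moment_at (Suc (Suc ?n))" using even_moment_at by simp
    moreover have "expansion_at (Suc (Suc ?n))" using 1 Suc expansion_at_Suc by blast
    ultimately show ?case
      using expansion_at_Suc[of "Suc (Suc ?n)"] even_moment_at[of "Suc (Suc ?n)"] odd_moment_at[of
          "Suc (Suc ?n)"]
      by simp
  qed
  from this[of "n div 2"] show ?thesis by (cases "even n") (auto elim!: evenE oddE)
qed

text \<open>Markov's inequality for the power \<open>2 * k\<close> bounds the mass beyond
  \<open>K + 1\<close> by \<open>(K / (K + 1)) ^ (2 * k)\<close>; the added 1 makes this tend to
  0.\<close>

lemma compactly_supported: "compactly_supported_law \<mu>"
proof -
  let ?A = "{x. \<bar>x\<bar> \<ge> K + 1}"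
  have "measure \<mu> ?A \<le> ((K / (K + 1))\<^sup>2) ^ k" for k
  proof -
    have int: "integrable \<mu> (\<lambda>x. x ^ (2 * k))" and eq: "expectation (\<lambda>x. x ^ (2 * k)) = c (2 * k)"
      using moment_at_all by (auto simp: moment_at_def)
    have "?A \<subseteq> {x. (K + 1) ^ (2 * k) \<le> x ^ (2 * k)}"
    proof
      fix x assume "x \<in> ?A"
      then have "(K + 1) ^ (2 * k) \<le> \<bar>x\<bar> ^ (2 * k)" using K_nonneg by (intro power_mono) auto
      then show "x \<in> {x. (K + 1) ^ (2 * k) \<le> x ^ (2 * k)}" by (simp add: power_even_abs)
    qed
    moreover have "{x. (K + 1) ^ (2 * k) \<le> x ^ (2 * k)} \<in> sets \<mu>" by (simp add: sets_mu)
    ultimately have "measure \<mu> ?A \<le> measure \<mu> {x. (K + 1) ^ (2 * k) \<le> x ^ (2 * k)}"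
      by (rule finite_measure_mono)
    also have "\<dots> \<le> expectation (\<lambda>x. x ^ (2 * k)) / (K + 1) ^ (2 * k)"
      using integral_Markov_inequality_measure[OF int, of UNIV "(K + 1) ^ (2 * k)"] K_nonneg
        sets_eq_imp_space_eq[OF sets_mu] by simp
    also have "\<dots> \<le> K ^ (2 * k) / (K + 1) ^ (2 * k)"
      unfolding eq using c_bound[of "2 * k"] K_nonneg by (intro divide_right_mono) auto
    also have "\<dots> = ((K / (K + 1))\<^sup>2) ^ k" by (simp add: power_divide power_mult)
    finally show ?thesis .
  qed
  moreover have "(\<lambda>k. ((K / (K + 1))\<^sup>2) ^ k) \<longlonglongrightarrow> 0"
    using K_nonneg by (intro LIMSEQ_realpow_zero) (auto simp: power2_eq_square divide_simps
        intro!: mult_strict_mono')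
  ultimately have "measure \<mu> ?A \<le> 0"
    by (intro LIMSEQ_le_const) auto
  then have "?A \<in> null_sets \<mu>"
    by (auto simp: null_sets_def emeasure_eq_measure sets_mu intro: antisym)
  then have "AE x in \<mu>. x \<notin> ?A" by (rule AE_not_in)
  then have "AE x in \<mu>. \<bar>x\<bar> \<le> K + 1" by eventually_elim auto
  then show ?thesis unfolding compactly_supported_law_def using prob_space_axioms sets_mu by blast
qed

end

section \<open>Subordination\<close>

text \<open>Comparison with a geometric series of ratio below \<open>1 / 2\<close>. This ratio keeps
  the deviation from \<open>f 0\<close> below 1, which later decides the sign of an imaginary
  part.\<close>

lemma power_series_bounds:
  fixes f :: "nat \<Rightarrow> complex"
  assumes f: "\<And>n. norm (f n) \<le> K ^ n" and K: "K \<ge> 0" and z: "norm z * K < 1 / 2"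
  shows "summable (\<lambda>n. norm (f n * z ^ n))"
    and "norm (suminf (\<lambda>n. f n * z ^ n)) \<le> 2"
    and "norm (suminf (\<lambda>n. f n * z ^ n) - f 0) < 1"
proof -
  let ?q = "norm z * K"
  have q: "0 \<le> ?q" "?q < 1" using z K by auto
  have le: "norm (f n * z ^ n) \<le> ?q ^ n" for n
    using mult_right_mono[OF f[of n], of "norm z ^ n"]
    by (simp add: norm_mult norm_power power_mult_distrib mult_ac)
  have geo: "summable (\<lambda>n. ?q ^ n)" using q by (simp add: summable_geometric)
  show sum: "summable (\<lambda>n. norm (f n * z ^ n))"
    using summable_comparison_test'[OF geo, of 0 "\<lambda>n. norm (f n * z ^ n)"] le by simp
  have "norm (suminf (\<lambda>n. f n * z ^ n)) \<le> suminf (\<lambda>n. ?q ^ n)"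
    using le geo by (rule norm_suminf_le)
  also have "\<dots> = 1 / (1 - ?q)" using q by (simp add: suminf_geometric)
  also have "\<dots> \<le> 2" using z by (simp add: field_simps)
  finally show "norm (suminf (\<lambda>n. f n * z ^ n)) \<le> 2" .
  have "suminf (\<lambda>n. f n * z ^ n) - f 0 = suminf (\<lambda>n. f (Suc n) * z ^ Suc n)"
    using suminf_split_head[OF summable_norm_cancel[OF sum]] by simp
  moreover have "norm (suminf (\<lambda>n. f (Suc n) * z ^ Suc n)) \<le> suminf (\<lambda>n. ?q ^ Suc n)"
    using le geo by (intro norm_suminf_le) (auto simp del: power_Suc simp: summable_Suc_iff)
  moreover have "suminf (\<lambda>n. ?q ^ Suc n) = 1 / (1 - ?q) - 1"
    using suminf_split_head[OF geo] q by (simp add: suminf_geometric)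
  moreover have "1 / (1 - ?q) - 1 < 1" using z by (simp add: field_simps)
  ultimately show "norm (suminf (\<lambda>n. f n * z ^ n) - f 0) < 1" by simp
qed

locale free_semicircular_sum = prob_space M + fock m "of_real t"
  for M :: "real measure" and m :: "nat \<Rightarrow> complex" and t :: real +
  fixes R :: real
  assumes sets_M [measurable_cong]: "sets M = sets borel"
    and AE_M: "AE x in M. \<bar>x\<bar> \<le> R" and R: "R \<ge> 0" and t: "t \<ge> 0"
    and m: "m k = of_real (expectation (\<lambda>x. x ^ k))"
begin

text \<open>The conditional expectation of \<open>(x + y) ^ n\<close> onto the polynomials in
  \<open>x\<close>, evaluated at a point.\<close>

definition q :: "nat \<Rightarrow> real \<Rightarrow> complex" where
  "q n x = sum_moment n (geometric (of_real x))"

definition mom :: "nat \<Rightarrow> complex" where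
  "mom n = sum_moment n (vacuum m)"

definition K :: real where "K = R + 1 + t"

lemma K_ge: "K \<ge> 1" using R t by (simp add: K_def)

lemma integrable_power: "integrable M (\<lambda>x. complex_of_real x ^ k)"
proof -
  have "integrable M (\<lambda>x. complex_of_real (x ^ k))"
    using compactly_supported_law_integrable_power[OF prob_space_axioms sets_M AE_M]
    by (simp del: of_real_power)
  then show ?thesis by simp
qed

lemma m_eq: "m k = (\<integral>x. complex_of_real x ^ k \<partial>M)"
  by (simp add: m flip: of_real_power)

lemma norm_m: "norm (m k) \<le> R ^ k"
proof -
  have "norm (m k) \<le> (\<integral>x. norm (complex_of_real x ^ k) \<partial>M)"
    unfolding m_eq by (rule integral_norm_bound)
  also have "\<dots> \<le> (\<integral>x. R ^ k \<partial>M)"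
  proof (rule integral_mono_AE)
    show "AE x in M. norm (complex_of_real x ^ k) \<le> R ^ k"
      using AE_M by eventually_elim (simp add: norm_power power_mono)
  qed (use integrable_power in auto)
  finally show ?thesis using prob_space by simp
qed

lemma norm_mom: "norm (mom n) \<le> K ^ n"
  using norm_sum_moment_vacuum_le[OF R norm_m, of n] t by (simp add: mom_def K_def)

lemma norm_q: "\<bar>x\<bar> \<le> R \<Longrightarrow> norm (q n x) \<le> K ^ n"
  using norm_sum_moment_geometric_le[OF norm_m, of "of_real x" n] t by (simp add: q_def K_def)

lemma mom_0: "mom 0 = 1" by (simp add: mom_def sum_moment_0 vacuum_def m_0)

lemma q_0: "q 0 x = 1" by (simp add: q_def sum_moment_0 geometric_def)

lemma q_Suc: "q (Suc n) x = of_real x * q n x + of_real t * (\<Sum>j<n. mom j * q (n - 1 - j) x)"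
  unfolding q_def mom_def by (rule sum_moment_geometric_Suc)

lemma mom_eq: "mom n = (\<integral>x. q n x \<partial>M)" and integrable_q: "integrable M (q n)"
  using vacuum_sum_moment[OF integrable_power m_eq] by (simp_all add: mom_def q_def[abs_def])

definition S :: "complex \<Rightarrow> complex" where
  "S z = suminf (\<lambda>n. mom n * z ^ n)"

context
  fixes z :: complex
  assumes z: "norm z * K < 1 / 2"
begin

text \<open>In generating series the convolution in \<open>q_Suc\<close> becomes a Cauchy product,
  so the series \<open>Q\<close> satisfies \<open>Q = 1 + z x Q + t z\<^sup>2 S Q\<close>.\<close>

lemma q_generating_function:
  assumes x: "\<bar>x\<bar> \<le> R"
  shows "suminf (\<lambda>n. q n x * z ^ n) * (1 - z * of_real x - of_real t * z\<^sup>2 * S z) = 1"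
proof -
  let ?Q = "\<lambda>n. q n x * z ^ n" and ?S = "\<lambda>n. mom n * z ^ n"
  have K: "K \<ge> 0" using K_ge by simp
  have sQ: "summable (\<lambda>n. norm (?Q n))" and sS: "summable (\<lambda>n. norm (?S n))"
    using power_series_bounds(1)[OF norm_q[OF x] K z] power_series_bounds(1)[OF norm_mom K z] by
        auto
  note Q = summable_norm_cancel[OF sQ]
  define C where "C n = (\<Sum>j\<le>n. ?S j * ?Q (n - j))" for n
  have C: "C sums (S z * suminf ?Q)"
    unfolding C_def S_def by (rule Cauchy_product_sums[OF sS sQ])
  \<comment> \<open>The Cauchy product shifted by one index, with value 0 at 0 because the
    convolution in \<open>q_Suc\<close> is empty for \<open>n = 0\<close>.\<close>
  define D where "D n = (case n of 0 \<Rightarrow> 0 | Suc k \<Rightarrow> C k)" for n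
  have D: "D sums (S z * suminf ?Q)"
    using C sums_Suc_iff[of D] by (simp add: D_def)
  have "?Q (Suc n) = z * of_real x * ?Q n + of_real t * z\<^sup>2 * (if n = 0 then 0 else C (n - 1))"
      for n
  proof (cases n)
    case 0
    then show ?thesis by (simp add: q_Suc)
  next
    case (Suc k)
    have "(\<Sum>j<Suc k. mom j * q (Suc k - 1 - j) x) * z ^ k = C k"
      unfolding C_def lessThan_Suc_atMost sum_distrib_right
      by (intro sum.cong refl) (auto simp: power_add[symmetric])
    then have "of_real t * z\<^sup>2 * ((\<Sum>j<n. mom j * q (n - 1 - j) x) * z ^ k) = of_real t * z\<^sup>2 * C
        (n - 1)"
      unfolding Suc by (simp only: diff_Suc_1)
    then show ?thesis
      by (simp only: q_Suc) (simp add: Suc power2_eq_square distrib_left distrib_right mult_ac)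
  qed
  then have eq: "?Q (Suc n) = z * of_real x * ?Q n + of_real t * z\<^sup>2 * D n" for n
    by (simp add: D_def split: nat.splits)
  have "(\<lambda>n. z * of_real x * ?Q n + of_real t * z\<^sup>2 * D n) sums
      (z * of_real x * suminf ?Q + of_real t * z\<^sup>2 * (S z * suminf ?Q))"
    using Q D by (intro sums_add sums_mult) auto
  then have "(\<lambda>n. ?Q (Suc n)) sums (z * of_real x * suminf ?Q + of_real t * z\<^sup>2 * (S z * suminf
      ?Q))"
    by (simp only: eq)
  moreover have "suminf ?Q = 1 + suminf (\<lambda>n. ?Q (Suc n))"
    using suminf_split_head[OF Q] by (simp add: q_0)
  ultimately have "suminf ?Q = 1 + (z * of_real x * suminf ?Q + of_real t * z\<^sup>2 * (S z * suminf
      ?Q))"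
    by (simp only: sums_iff)
  then show ?thesis by (simp add: algebra_simps)
qed

lemma S_integral: "S z = (\<integral>x. 1 / (1 - z * of_real x - of_real t * z\<^sup>2 * S z) \<partial>M)"
proof -
  have K: "K \<ge> 0" using K_ge by simp
  have int: "integrable M (\<lambda>x. q n x * z ^ n)" for n
    using integrable_q by simp
  have "AE x in M. summable (\<lambda>n. norm (q n x * z ^ n))"
    using AE_M by eventually_elim (rule power_series_bounds(1)[OF norm_q K z])
  moreover have "summable (\<lambda>n. \<integral>x. norm (q n x * z ^ n) \<partial>M)"
  proof (rule summable_comparison_test'[where N = 0])
    show "summable (\<lambda>n. (norm z * K) ^ n)" using z K by (simp add: summable_geometric)
    fix n
    have "norm (q n x * z ^ n) \<le> (norm z * K) ^ n" if "\<bar>x\<bar> \<le> R" for x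
      using mult_right_mono[OF norm_q[OF that, of n], of "norm z ^ n"]
      by (simp add: norm_mult norm_power power_mult_distrib mult.commute)
    then have "AE x in M. norm (q n x * z ^ n) \<le> (norm z * K) ^ n"
      using AE_M by (auto elim: eventually_mono)
    then have "(\<integral>x. norm (q n x * z ^ n) \<partial>M) \<le> (\<integral>x. (norm z * K) ^ n \<partial>M)"
      by (rule integral_mono_AE[OF integrable_norm[OF int] integrable_const])
    then show "norm (\<integral>x. norm (q n x * z ^ n) \<partial>M) \<le> (norm z * K) ^ n" using prob_space by simp
  qed
  ultimately have "(\<lambda>n. \<integral>x. q n x * z ^ n \<partial>M) sums (\<integral>x. suminf (\<lambda>n. q n x * z ^ n) \<partial>M)"
    using int by (intro sums_integral)
  then have "S z = (\<integral>x. suminf (\<lambda>n. q n x * z ^ n) \<partial>M)"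
    by (simp add: sums_iff S_def mom_eq)
  also have "\<dots> = (\<integral>x. 1 / (1 - z * of_real x - of_real t * z\<^sup>2 * S z) \<partial>M)"
  proof (rule integral_cong_AE)
    show "AE x in M. suminf (\<lambda>n. q n x * z ^ n) = 1 / (1 - z * of_real x - of_real t * z\<^sup>2 * S z)"
      using AE_M
    proof eventually_elim
      case (elim x)
      let ?d = "1 - z * of_real x - of_real t * z\<^sup>2 * S z"
      note gf = q_generating_function[OF elim]
      have "?d \<noteq> 0"
      proof
        assume "?d = 0"
        with gf show False by (simp only: mult_zero_right zero_neq_one)
      qed
      then show ?case using gf by (rule eq_divide_imp)
    qed
    have "q n \<in> borel_measurable M" for n using integrable_q by (rule borel_measurable_integrable)
    then show "(\<lambda>x. suminf (\<lambda>n. q n x * z ^ n)) \<in> borel_measurable M"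
      by (intro borel_measurable_suminf) simp
  qed (simp add: measurable_cong_sets[OF sets_M refl])
  finally show ?thesis .
qed

end

text \<open>Here \<open>1 / z\<close> is the spectral variable and \<open>z * S z\<close> is the
  moment series \<open>G\<close> at that point; the formula is the integrated generating function
  with \<open>z\<close> cancelled.\<close>

lemma subordination:
  assumes z: "norm z * K < 1 / 2" "z \<noteq> 0"
  shows "z * S z = (\<integral>x. 1 / ((1 / z - of_real t * (z * S z)) - of_real x) \<partial>M)"
proof -
  have "z * S z = (\<integral>x. z * (1 / (1 - z * of_real x - of_real t * z\<^sup>2 * S z)) \<partial>M)"
    using S_integral[OF z(1)] by (subst integral_mult_right_zero) simp
  also have "(\<lambda>x. z * (1 / (1 - z * of_real x - of_real t * z\<^sup>2 * S z)))
     = (\<lambda>x. 1 / ((1 / z - of_real t * (z * S z)) - of_real x))"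
  proof
    fix x :: real
    have "1 - z * of_real x - of_real t * z\<^sup>2 * S z = z * ((1 / z - of_real t * (z * S z)) -
        of_real x)"
      using z(2) by (simp add: algebra_simps power2_eq_square)
    then show "z * (1 / (1 - z * of_real x - of_real t * z\<^sup>2 * S z)) = 1 / ((1 / z - of_real t *
        (z * S z)) - of_real x)"
      using z(2) by simp
  qed
  finally show ?thesis .
qed

lemma mom_real: "mom n = of_real (Re (mom n))"
proof -
  have "mom n \<in> \<real>" unfolding mom_def by (rule sum_moment_vacuum_in_Reals) (auto simp: m)
  then show ?thesis by (simp add: of_real_Re)
qed

text \<open>Only moments of \<open>P\<close> enter, so any compactly supported law known to have the
  moments \<open>mom\<close> completes the Fock realisation. Orthogonality is carried over to
  variance \<open>t\<close> by the homogeneity \<open>cheb_scale\<close>.\<close>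

lemma is_free_additive_convolution_semicircular:
  assumes P: "compactly_supported_law P" and moments: "\<And>n. mom n = of_real (\<integral>x. x ^ n \<partial>P)"
  shows "is_free_additive_convolution M (distr semicircle_law borel (\<lambda>y. sqrt t * y)) P"
proof -
  let ?N = "distr semicircle_law borel (\<lambda>y. sqrt t * y)"
  have t2: "(complex_of_real (sqrt t))\<^sup>2 = of_real t" using t by (simp flip: of_real_power)
  have ch: "cheb (of_real t) (complex_of_real (sqrt t * y)) n = of_real (sqrt t ^ n * cheb 1 y n)"
      for y n
    using cheb_scale[of "complex_of_real (sqrt t)" "of_real y" n] by (simp add: t2 cheb_of_real)
  have meas: "(\<lambda>y. cheb (of_real t) (complex_of_real y) n) \<in> borel_measurable borel" for n
  proof -
    have "continuous_on UNIV (\<lambda>y. cheb (of_real t) (complex_of_real y) n)"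
      by (induction "complex_of_real t" "0 :: complex" n rule: cheb.induct) (auto intro!:
          continuous_intros)
    then show ?thesis by (rule borel_measurable_continuous_onI)
  qed
  have int_N: "integrable ?N (\<lambda>y. cheb (of_real t) (complex_of_real y) n)" for n
  proof (subst integrable_distr_eq)
    have "integrable semicircle_law (\<lambda>y. complex_of_real (sqrt t ^ n * cheb 1 y n))"
      by (rule integrable_semicircle_law[where B = "sqrt t ^ n * real (Suc n)"])
        (use t in \<open>auto simp: norm_mult norm_power abs_mult power_abs abs_cheb_le simp del:
            of_nat_Suc intro!: mult_left_mono\<close>)
    then show "integrable semicircle_law (\<lambda>y. cheb (of_real t) (complex_of_real (sqrt t * y)) n)"
      by (simp only: ch)
  qed (use meas in auto)
  have cheb_N: "(\<integral>y. cheb (of_real t) (complex_of_real y) n \<partial>?N) = (if n = 0 then 1 else 0)" for n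
  proof -
    have "(\<integral>y. cheb (of_real t) (complex_of_real y) n \<partial>?N)
        = (\<integral>y. cheb (of_real t) (complex_of_real (sqrt t * y)) n \<partial>semicircle_law)"
      using meas by (intro integral_distr) auto
    also have "\<dots> = of_real (\<integral>y. sqrt t ^ n * cheb 1 y n \<partial>semicircle_law)"
      unfolding ch by (rule integral_complex_of_real)
    also have "\<dots> = (if n = 0 then 1 else 0)"
      by (simp add: integral_cheb_semicircle_law)
    finally show ?thesis .
  qed
  have "compactly_supported_law ?N"
    unfolding compactly_supported_law_def
  proof (intro conjI exI[of _ "sqrt t * 2"])
    show "prob_space ?N" by (intro semicircle.prob_space_distr) simp
    show "AE y in ?N. \<bar>y\<bar> \<le> sqrt t * 2"
    proof (subst AE_distr_iff)
      show "AE y in semicircle_law. \<bar>sqrt t * y\<bar> \<le> sqrt t * 2"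
        using AE_semicircle_law by eventually_elim (use t in \<open>auto simp: abs_mult intro!:
            mult_left_mono\<close>)
    qed auto
  qed simp
  moreover have "ev (vacuum m) (ncY ^ k) = of_real (\<integral>y. y ^ k \<partial>?N)" for k
    using vacuum_Y_power[OF int_N cheb_N, of k] by (simp flip: of_real_power)
  ultimately have "has_law (ev (vacuum m)) ncY ?N" by (simp add: has_law_def)
  moreover have "has_law (ev (vacuum m)) ncX M"
    unfolding has_law_def compactly_supported_law_def
    using prob_space_axioms sets_M AE_M vacuum_X_power m by auto
  moreover have "has_law (ev (vacuum m)) (ncX + ncY) P"
    using P moments by (simp add: has_law_def mom_def sum_moment_def)
  moreover have "nc_prob_space nc_scale (ev (vacuum m))"
    by (rule nc_prob_space_ev) (simp add: vacuum_def m_0)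
  ultimately show ?thesis
    unfolding is_free_additive_convolution_def using free_elements_vacuum by blast
qed

end

section \<open>Identification of \<open>\<mu>\<close> with the law of the free sum\<close>

theorem proposition1p2:
  fixes a \<nu> \<gamma> :: real and \<mu> :: "real measure"
  assumes "\<nu> \<ge> a\<^sup>2" and "\<gamma> > 0"
    and "is_kernel_law a \<nu> \<gamma> \<mu>"
  shows "\<mu> = distr (marchenko_pastur_law \<gamma>) borel (\<lambda>y. a * (y - 1))
             \<boxplus> distr semicircle_law borel (\<lambda>y. sqrt (\<gamma> * (\<nu> - a\<^sup>2)) * y)"
proof -
  define M where "M = distr (marchenko_pastur_law \<gamma>) borel (\<lambda>y. a * (y - 1))"
  define t where "t = \<gamma> * (\<nu> - a\<^sup>2)"
  \<comment> \<open>Bounds \<open>a (y - 1)\<close> on the Marchenko-Pastur support, and is also the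
    radius beyond which \<open>cauchy_transform_scaled_mp\<close> applies.\<close>
  define R where "R = \<bar>a\<bar> * ((1 + sqrt \<gamma>)\<^sup>2 + 1)"
  define m where "m k = complex_of_real (\<integral>x. x ^ k \<partial>M)" for k :: nat
  have t: "t \<ge> 0" using assms by (simp add: t_def)
  have "R \<ge> 0" by (simp add: R_def)
  have meas: "(\<lambda>y. a * (y - 1)) \<in> marchenko_pastur_law \<gamma> \<rightarrow>\<^sub>M borel"
    unfolding measurable_cong_sets[OF sets_mp[OF assms(2)] refl] by measurable
  have prob: "prob_space M"
    unfolding M_def by (rule prob_space.prob_space_distr[OF prob_space_mp[OF assms(2)] meas])
  have AE: "AE x in M. \<bar>x\<bar> \<le> R"
    unfolding M_def
  proof (subst AE_distr_iff[OF meas])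
    show "AE y in marchenko_pastur_law \<gamma>. \<bar>a * (y - 1)\<bar> \<le> R"
      using AE_mp[OF assms(2)] by eventually_elim (auto simp: R_def abs_mult intro!: mult_left_mono)
  qed simp
  interpret F: free_semicircular_sum M m t R
  proof (intro free_semicircular_sum.intro free_semicircular_sum_axioms.intro fock.intro)
    show "m 0 = 1" using prob_space.prob_space[OF prob] by (simp add: m_def)
  qed (use prob AE t \<open>R \<ge> 0\<close> in \<open>simp_all add: m_def M_def\<close>)
  have \<mu>: "prob_space \<mu>" "sets \<mu> = sets borel"
    and kernel: "\<And>z m. Im z > 0 \<Longrightarrow> Im m > 0 \<Longrightarrow> kernel_law_equation a \<nu> \<gamma> z m \<Longrightarrow> m =
        stieltjes_transform \<mu> z"
    using assms(3) by (auto simp: is_kernel_law_def)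
  \<comment> \<open>The threshold serves twice: it gives \<open>norm z * F.K < 1 / 2\<close>, and,
    as \<open>F.K = R + 1 + t\<close> and \<open>norm G \<le> 2\<close>, it puts the subordinated
    point \<open>\<omega>\<close> beyond \<open>R\<close>.\<close>
  have expansion: "(\<integral>x. 1 / (complex_of_real x - \<i> * of_real y) \<partial>\<mu>)
      = - (suminf (\<lambda>n. of_real (Re (F.mom n)) * (1 / (\<i> * of_real y)) ^ Suc n))" if y: "y \<ge> 2 *
          F.K + 1" for y
  proof -
    define z where "z = 1 / (\<i> * complex_of_real y)"
    have "y > 0" using y F.K_ge by linarith
    then have z: "z \<noteq> 0" "1 / z = \<i> * of_real y" "norm z = 1 / y"
      by (auto simp: z_def norm_divide norm_mult)
    have zK: "norm z * F.K < 1 / 2" using y \<open>y > 0\<close> by (simp add: z field_simps)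
    have K: "F.K \<ge> 0" using F.K_ge by simp
    define G where "G = z * F.S z"
    define \<omega> where "\<omega> = 1 / z - of_real t * G"
    note S = power_series_bounds[OF F.norm_mom K zK, folded F.S_def]
    have "norm G \<le> 2"
    proof -
      have "norm G \<le> 1 * 2" unfolding G_def norm_mult
        using S(2) y F.K_ge \<open>y > 0\<close> by (intro mult_mono) (auto simp: z)
      then show ?thesis by simp
    qed
    have "norm \<omega> \<ge> y - t * 2"
    proof -
      have "t * norm G \<le> t * 2" using \<open>norm G \<le> 2\<close> t by (rule mult_left_mono)
      moreover have "norm (1 / z) = y" using z \<open>y > 0\<close> by (simp add: norm_mult)
      ultimately show ?thesis
        using norm_triangle_ineq2[of "1 / z" "of_real t * G"] t unfolding \<omega>_def norm_mult by simp
    qed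
    moreover have "y - t * 2 > R" using y \<open>R \<ge> 0\<close> by (simp add: F.K_def)
    ultimately have "norm \<omega> > R" by simp
    note mp = cauchy_transform_scaled_mp[OF assms(2) this[unfolded R_def], folded M_def]
    have "G = (\<integral>x. 1 / (\<omega> - of_real x) \<partial>M)"
      unfolding G_def \<omega>_def by (rule F.subordination[OF zK z(1)])
    note mp = mp[folded this]
    \<comment> \<open>The sign is that of \<open>1 / (x - z)\<close> against
      \<open>1 / (z - x)\<close>; the shift \<open>- t G\<close> inside \<open>\<omega>\<close>
      supplies the last term of the kernel equation.\<close>
    have "kernel_law_equation a \<nu> \<gamma> (\<i> * of_real y) (- G)"
    proof -
      have "- 1 / (- G) = 1 / G" by simp
      also have "\<dots> = \<omega> + of_real a - of_real a / (1 - of_real (a * \<gamma>) * G)" by (rule mp)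
      also have "\<dots> = \<i> * of_real y + of_real a * (1 - 1 / (1 + of_real (a * \<gamma>) * (- G)))
               + of_real (\<gamma> * (\<nu> - a\<^sup>2)) * (- G)"
        unfolding \<omega>_def z(2) t_def[symmetric] by (simp add: right_diff_distrib)
      finally show ?thesis by (simp only: kernel_law_equation_def)
    qed
    \<comment> \<open>\<open>G\<close> is not yet known to be the transform of a measure, so this is
      checked on the series: \<open>F.S z\<close> lies within 1 of its constant term 1, and
      \<open>z = - \<i> / y\<close>.\<close>
    moreover have "Im (- G) > 0"
    proof -
      have "\<bar>Re (F.S z - 1)\<bar> < 1" using S(3) abs_Re_le_cmod[of "F.S z - 1"] by (simp add: F.mom_0)
      then have "Re (F.S z) > 0" by simp
      moreover have "z = - \<i> * of_real (1 / y)" using \<open>y > 0\<close> by (simp add: z_def field_simps)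
      then have "Im (- G) = Re (F.S z) / y" by (simp add: G_def)
      ultimately show ?thesis using \<open>y > 0\<close> by simp
    qed
    ultimately have "- G = stieltjes_transform \<mu> (\<i> * of_real y)"
      using \<open>y > 0\<close> by (intro kernel) auto
    moreover have "G = suminf (\<lambda>n. of_real (Re (F.mom n)) * z ^ Suc n)"
    proof -
      have "G = suminf (\<lambda>n. z * (F.mom n * z ^ n))"
        unfolding G_def F.S_def by (rule suminf_mult[symmetric, OF summable_norm_cancel[OF S(1)]])
      also have "(\<lambda>n. z * (F.mom n * z ^ n)) = (\<lambda>n. of_real (Re (F.mom n)) * z ^ Suc n)"
        unfolding F.mom_real[symmetric] by (simp add: mult_ac)
      finally show ?thesis .
    qed
    ultimately show ?thesis by (simp only: stieltjes_transform_def inverse_eq_divide z_def)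
  qed
  interpret E: stieltjes_expansion \<mu> "\<lambda>n. Re (F.mom n)" F.K "2 * F.K + 1"
  proof (intro stieltjes_expansion.intro stieltjes_expansion_axioms.intro)
    show "\<bar>Re (F.mom n)\<bar> \<le> F.K ^ n" for n
      using abs_Re_le_cmod[of "F.mom n"] F.norm_mom[of n] by linarith
  qed (use \<mu> F.K_ge expansion in \<open>auto simp: F.mom_0\<close>)
  have "is_free_additive_convolution M (distr semicircle_law borel (\<lambda>y. sqrt t * y)) \<mu>"
  proof (rule F.is_free_additive_convolution_semicircular[OF E.compactly_supported])
    show "F.mom n = of_real (\<integral>x. x ^ n \<partial>\<mu>)" for n
      using E.moment_at_all[of n] F.mom_real[of n] by (simp add: E.moment_at_def)
  qed
  then show ?thesis
    unfolding M_def t_def by (rule free_additive_convolution_eqI[symmetric])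
qed

end
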